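(* Let $\mathfrak S_3=\{e,(12),(23),(13),(123),(132)\}$ be the symmetric group of degree 3, with the product $\sigma\tau$ of permutations read from left to right (first $\sigma$, then $\tau$). Let $H^o=\{e,(12)\}$ and let $\mu=(\mu_k)_{k\in-\mathbf N}$ be given by $\mu_k=\nu^o$ for every $k\in-\mathbf N$, where $\nu^o(\{e\})=\nu^o(\{(12)\})=1/2$. Consider the equation $\eta_k=\eta_{k-1}\cdot\xi_k$, $k\in-\mathbf N$, on $G=\mathfrak S_3$ with noise law $\mu$. Then there exists a solution $\mathbf P^o\in\mathcal P_\mu$ such that the following hold: (i) Each $\eta_k$ under $\mathbf P^o$ is uniformly distributed on $H^o$. (ii) The set of extremal points is $\mathrm{ex}(\mathcal P_\mu)=\{\mathbf P^o,\mathbf P^1,\mathbf P^2\}$, where $\mathbf P^1:=T_{(13)}(\mathbf P^o)$ and $\mathbf P^2:=T_{(123)}(\mathbf P^o)$. (iii) The isotropic subgroup is $H_\mu(\mathbf P^o)=H^o$. Hence $$\{e\}=H^1_\mu\subsetneq H_\mu(\mathbf P^o)=H^o\subsetneq H^s_\mu=H^2_\mu=\mathfrak S_3.$$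
   Context: $-\mathbf N=\{0,-1,-2,\dots\}$; $e$ is the unit. Write $G=\mathfrak S_3$. On $G^{-\mathbf N}$ let $\eta=(\eta_k)_{k\in-\mathbf N}$ be the coordinate process, and set $\xi_k=(\eta_{k-1})^{-1}\cdot\eta_k$ for $k\in-\mathbf N$. Let $\mathcal F^\eta_k=\sigma(\eta_k,\eta_{k-1},\dots)$ and $\mathcal F^\xi_k=\sigma(\xi_k,\xi_{k-1},\dots)$. A solution with noise law $\mu$ is a probability measure $\mathbf P$ on $G^{-\mathbf N}$ such that, for every $k\in-\mathbf N$, under $\mathbf P$: (i) $\xi_k$ is independent of $\mathcal F^\eta_{k-1}$; (ii) $\xi_k$ has law $\mu_k$. The set of all solutions is $\mathcal P_\mu$; it is convex and $\mathrm{ex}(\mathcal P_\mu)$ is its set of extremal points. For $g\in G$ and $\mathbf P\in\mathcal P_\mu$, $T_g(\mathbf P)(\cdot)=\mathbf P(g\cdot\eta\in\cdot)$, where $g\cdot\eta=(g\cdot\eta_k)_{k\in-\mathbf N}$; for $\mathbf P\in\mathrm{ex}(\mathcal P_\mu)$, $H_\mu(\mathbf P)=\{g\in G: T_g(\mathbf P)=\mathbf P\}$. Let $\mathcal G$ be the totality of irreducible unitary representations $\rho$ of $G$ on finite-dimensional spaces $V^\rho$. For an extremal point $\mathbf P\in\mathrm{ex}(\mathcal P_\mu)$ let $\mathcal H^s_\mu$ be the set of $\rho\in\mathcal G$ such that, for every $k\in-\mathbf N$, $\rho(\eta_k)$ is $\mathcal F^\xi_k$-measurable $\mathbf P$-a.s.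 (i.e. coincides $\mathbf P$-a.s. with an $\mathcal F^\xi_k$-measurable random element); this set does not depend on the choice of the extremal point. For $\rho\in\mathcal G$ put $R_k=\int_G\rho(g)\,\mu_k(dg)$ and $$r^1_k[\rho]=\lim_{n\to\infty}\|R_{k-n}R_{k-n+1}\cdots R_k\|,\qquad r^2_k[\rho]=\lim_{n\to\infty}\left|\det(R_{k-n}R_{k-n+1}\cdots R_k)\right|,$$ with $\|\cdot\|$ the operator norm on $V^\rho$. For $i=1,2$ let $\mathcal H^i_\mu=\{\rho\in\mathcal G: r^i_k[\rho]>0\text{ for some }k\in-\mathbf N\}$. For $i\in\{1,2,s\}$ let $H^i_\mu=\{g\in G:\rho(g)=\mathrm{id}\text{ for every }\rho\in\mathcal H^i_\mu\}$. *)

theory Defs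
  imports
    "HOL-Probability.Probability"
    "HOL-Algebra.Sym_Groups"
    "Jordan_Normal_Form.Schur_Decomposition"
    "Jordan_Normal_Form.VS_Connect"
begin

section \<open>Solutions of the equation on a group indexed by the non-positive integers\<close>

definition paths :: "('a, 'b) monoid_scheme \<Rightarrow> (int \<Rightarrow> 'a) measure" where
  "paths G = PiM {..0::int} (\<lambda>_. count_space (carrier G))"

definition noise :: "('a, 'b) monoid_scheme \<Rightarrow> int \<Rightarrow> (int \<Rightarrow> 'a) \<Rightarrow> 'a" where
  "noise G k \<eta> = inv\<^bsub>G\<^esub> (\<eta> (k - 1)) \<otimes>\<^bsub>G\<^esub> \<eta> k"

text \<open>The sigma-algebra on the path space generated by the variables \<open>X j\<close> with \<open>j \<le> k\<close>.\<close>

definition past :: "('a, 'b) monoid_scheme \<Rightarrow> (int \<Rightarrow> (int \<Rightarrow> 'a) \<Rightarrow> 'a) \<Rightarrow> int \<Rightarrow> (int \<Rightarrow> 'a) measure" where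
  "past G X k = sigma (space (paths G))
     {X j -` A \<inter> space (paths G) | j A. j \<le> k \<and> A \<subseteq> carrier G}"

definition past_eta :: "('a, 'b) monoid_scheme \<Rightarrow> int \<Rightarrow> (int \<Rightarrow> 'a) measure" where
  "past_eta G = past G (\<lambda>k \<eta>. \<eta> k)"

definition past_noise :: "('a, 'b) monoid_scheme \<Rightarrow> int \<Rightarrow> (int \<Rightarrow> 'a) measure" where
  "past_noise G = past G (noise G)"

definition solutions :: "('a, 'b) monoid_scheme \<Rightarrow> (int \<Rightarrow> 'a measure) \<Rightarrow> (int \<Rightarrow> 'a) measure set" where
  "solutions G \<mu> = {P. prob_space P \<and> sets P = sets (paths G) \<and>
     (\<forall>k\<le>0.
        prob_space.indep_set P
          (sets (vimage_algebra (space P) (noise G k) (count_space (carrier G))))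
          (sets (past_eta G (k - 1))) \<and>
        distr P (count_space (carrier G)) (noise G k) = \<mu> k)}"

definition extremal_solutions :: "('a, 'b) monoid_scheme \<Rightarrow> (int \<Rightarrow> 'a measure) \<Rightarrow> (int \<Rightarrow> 'a) measure set" where
  "extremal_solutions G \<mu> = {P \<in> solutions G \<mu>.
     \<forall>Q\<in>solutions G \<mu>. \<forall>R\<in>solutions G \<mu>. \<forall>t::real. 0 < t \<and> t < 1 \<and>
       (\<forall>A\<in>sets (paths G). measure P A = (1 - t) * measure Q A + t * measure R A)
       \<longrightarrow> Q = P \<and> R = P}"

text \<open>The restriction keeps the translated path inside the extensional function space
  underlying \<open>PiM\<close>.\<close>

definition translate :: "('a, 'b) monoid_scheme \<Rightarrow> 'a \<Rightarrow> (int \<Rightarrow> 'a) measure \<Rightarrow> (int \<Rightarrow> 'a) measure" where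
  "translate G g P = distr P (paths G) (\<lambda>\<eta>. \<lambda>k\<in>{..0::int}. g \<otimes>\<^bsub>G\<^esub> \<eta> k)"

definition isotropy :: "('a, 'b) monoid_scheme \<Rightarrow> (int \<Rightarrow> 'a) measure \<Rightarrow> 'a set" where
  "isotropy G P = {g \<in> carrier G. translate G g P = P}"

section \<open>Irreducible unitary representations\<close>

text \<open>A pair \<open>(n, \<rho>)\<close> is a unitary representation on \<open>V = \<complex>\<^sup>n\<close> with the standard inner product;
  up to unitary equivalence every finite-dimensional unitary representation has this form.\<close>

definition unitary_rep :: "('a, 'b) monoid_scheme \<Rightarrow> nat \<Rightarrow> ('a \<Rightarrow> complex mat) \<Rightarrow> bool" where
  "unitary_rep G n \<rho> \<longleftrightarrow>
     \<rho> \<in> hom G (ring_mat TYPE(complex) n ()) \<and>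
     (\<forall>g\<in>carrier G. mat_adjoint (\<rho> g) * \<rho> g = 1\<^sub>m n)"

definition irreducible_rep :: "('a, 'b) monoid_scheme \<Rightarrow> nat \<Rightarrow> ('a \<Rightarrow> complex mat) \<Rightarrow> bool" where
  "irreducible_rep G n \<rho> \<longleftrightarrow> n > 0 \<and>
     (\<forall>W. VectorSpace.subspace class_ring W (module_vec TYPE(complex) n) \<and>
          (\<forall>g\<in>carrier G. \<forall>w\<in>W. \<rho> g *\<^sub>v w \<in> W)
          \<longrightarrow> W = {0\<^sub>v n} \<or> W = carrier_vec n)"

definition unitary_irreps :: "('a, 'b) monoid_scheme \<Rightarrow> (nat \<times> ('a \<Rightarrow> complex mat)) set" where
  "unitary_irreps G = {(n, \<rho>). unitary_rep G n \<rho> \<and> irreducible_rep G n \<rho>}"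

definition rep_mean :: "(int \<Rightarrow> 'a measure) \<Rightarrow> nat \<Rightarrow> ('a \<Rightarrow> complex mat) \<Rightarrow> int \<Rightarrow> complex mat" where
  "rep_mean \<mu> n \<rho> k = mat n n (\<lambda>(i, j). \<integral>g. \<rho> g $$ (i, j) \<partial>\<mu> k)"

text \<open>\<open>rep_mean_prod \<mu> n \<rho> k m\<close> is the ordered product
  \<open>R\<^bsub>k - m\<^esub> R\<^bsub>k - m + 1\<^esub> \<dots> R\<^bsub>k\<^esub>\<close>.\<close>

primrec rep_mean_prod ::
  "(int \<Rightarrow> 'a measure) \<Rightarrow> nat \<Rightarrow> ('a \<Rightarrow> complex mat) \<Rightarrow> int \<Rightarrow> nat \<Rightarrow> complex mat" where
  "rep_mean_prod \<mu> n \<rho> k 0 = rep_mean \<mu> n \<rho> k"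
| "rep_mean_prod \<mu> n \<rho> k (Suc m) = rep_mean \<mu> n \<rho> (k - int (Suc m)) * rep_mean_prod \<mu> n \<rho> k m"

definition l2_norm :: "complex vec \<Rightarrow> real" where
  "l2_norm v = sqrt (\<Sum>i<dim_vec v. (cmod (vec_index v i))\<^sup>2)"

definition op_norm :: "complex mat \<Rightarrow> real" where
  "op_norm A = Sup {l2_norm (A *\<^sub>v v) | v. v \<in> carrier_vec (dim_col A) \<and> l2_norm v \<le> 1}"

definition r1 :: "(int \<Rightarrow> 'a measure) \<Rightarrow> nat \<Rightarrow> ('a \<Rightarrow> complex mat) \<Rightarrow> int \<Rightarrow> real" where
  "r1 \<mu> n \<rho> k = lim (\<lambda>m. op_norm (rep_mean_prod \<mu> n \<rho> k m))"

definition r2 :: "(int \<Rightarrow> 'a measure) \<Rightarrow> nat \<Rightarrow> ('a \<Rightarrow> complex mat) \<Rightarrow> int \<Rightarrow> real" where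
  "r2 \<mu> n \<rho> k = lim (\<lambda>m. cmod (Determinant.det (rep_mean_prod \<mu> n \<rho> k m)))"

definition reps1 :: "('a, 'b) monoid_scheme \<Rightarrow> (int \<Rightarrow> 'a measure) \<Rightarrow> (nat \<times> ('a \<Rightarrow> complex mat)) set" where
  "reps1 G \<mu> = {(n, \<rho>) \<in> unitary_irreps G. \<exists>k\<le>0. r1 \<mu> n \<rho> k > 0}"

definition reps2 :: "('a, 'b) monoid_scheme \<Rightarrow> (int \<Rightarrow> 'a measure) \<Rightarrow> (nat \<times> ('a \<Rightarrow> complex mat)) set" where
  "reps2 G \<mu> = {(n, \<rho>) \<in> unitary_irreps G. \<exists>k\<le>0. r2 \<mu> n \<rho> k > 0}"

text \<open>Measurability of a matrix-valued function is measurability of its entries.  The set is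
  parametrised by the law \<open>P\<close>, which is meant to be an extremal solution.\<close>

definition reps_s :: "('a, 'b) monoid_scheme \<Rightarrow> (int \<Rightarrow> 'a) measure \<Rightarrow> (nat \<times> ('a \<Rightarrow> complex mat)) set" where
  "reps_s G P = {(n, \<rho>) \<in> unitary_irreps G. \<forall>k\<le>0.
     \<exists>f :: (int \<Rightarrow> 'a) \<Rightarrow> complex mat.
       f \<in> space (paths G) \<rightarrow> carrier_mat n n \<and>
       (\<forall>i<n. \<forall>j<n. (\<lambda>\<eta>. f \<eta> $$ (i, j)) \<in> borel_measurable (past_noise G k)) \<and>
       (AE \<eta> in P. \<rho> (\<eta> k) = f \<eta>)}"

definition common_kernel :: "('a, 'b) monoid_scheme \<Rightarrow> (nat \<times> ('a \<Rightarrow> complex mat)) set \<Rightarrow> 'a set" where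
  "common_kernel G S = {g \<in> carrier G. \<forall>(n, \<rho>)\<in>S. \<rho> g = 1\<^sub>m n}"

definition H1 :: "('a, 'b) monoid_scheme \<Rightarrow> (int \<Rightarrow> 'a measure) \<Rightarrow> 'a set" where
  "H1 G \<mu> = common_kernel G (reps1 G \<mu>)"

definition H2 :: "('a, 'b) monoid_scheme \<Rightarrow> (int \<Rightarrow> 'a measure) \<Rightarrow> 'a set" where
  "H2 G \<mu> = common_kernel G (reps2 G \<mu>)"

definition Hs :: "('a, 'b) monoid_scheme \<Rightarrow> (int \<Rightarrow> 'a) measure \<Rightarrow> 'a set" where
  "Hs G P = common_kernel G (reps_s G P)"

section \<open>The symmetric group of degree 3 and the noise law\<close>

text \<open>The product is read from left to right, so this is the opposite of \<open>sym_group 3\<close>.\<close>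

definition S3 :: "(nat \<Rightarrow> nat) monoid" where
  "S3 = \<lparr>carrier = {p. p permutes {1..3}}, mult = (\<lambda>\<sigma> \<tau>. \<tau> \<circ> \<sigma>), one = id\<rparr>"

definition Ho :: "(nat \<Rightarrow> nat) set" where
  "Ho = {id, cycle_of_list [1, 2]}"

definition nuo :: "(nat \<Rightarrow> nat) measure" where
  "nuo = point_measure (carrier S3) (\<lambda>g. if g = id \<or> g = cycle_of_list [1, 2] then 1 / 2 else 0)"

end

theory Submission
  imports Defs
begin

text \<open>
  Most of the argument concerns an arbitrary finite group with noise uniform on a subgroup \<open>H\<close>.
  The noise moves a path only inside a left coset of \<open>H\<close>, so the coset of \<open>\<eta> k\<close> is almost surely
  constant in \<open>k\<close>; and since the noise is uniform on \<open>H\<close>, each step forgets where in the coset the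
  path was.  Given the coset, the coordinates are therefore independent and uniform on it, and a
  solution is determined by the law of its coset (\<open>solution_eqI\<close>).  Conditioning on the coset
  yields a solution again (\<open>conditioned_solution\<close>), so an extremal solution lives on a single
  coset; the solutions on one coset are the translates of the independent path, uniform on \<open>H\<close>
  (\<open>extremal_solutions_eq\<close>), and a translation fixes the latter exactly if it maps \<open>H\<close> to itself.

  For a representation \<open>\<rho>\<close> the mean of the noise is the projection onto the \<open>H\<close>-fixed vectors.
  It is idempotent, so the products of means do not vary and the limits can be read off: the
  determinant survives only if \<open>\<rho>\<close> is trivial on \<open>H\<close> (\<open>reps2_trivial_on_H\<close>), while the norm
  survives as soon as there is a nonzero fixed vector.  Measurability with respect to the noise
  again forces \<open>\<rho>\<close> to be trivial on \<open>H\<close> (\<open>reps_s_trivial_on_H\<close>): left translation of the path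
  does not change the noise, whereas the law of an extremal solution is invariant under the
  conjugate of \<open>H\<close> that stabilises its coset.

  In the symmetric group of degree three the conjugates of \<open>(12)\<close> are all the transpositions, which
  generate the group.  So a representation that is trivial on \<open>H\<close> is trivial, and the two common
  kernels are everything.  The representation by symmetries of an equilateral triangle is faithful
  and irreducible, and \<open>(12)\<close> acts in it as a reflection, which fixes an axis; it belongs to the
  representations with surviving norm and makes the remaining kernel trivial.
\<close>

(* only the left-coset reading of this symbol occurs below *)
no_notation subset_mset (infix \<open><#\<close> 50)

section \<open>Events of the path space\<close>

lemma space_paths: "space (paths G) = (\<Pi>\<^sub>E k\<in>{..0}. carrier G)"
  by (simp add: paths_def space_PiM)

lemma coordinate_in_carrier: "\<eta> \<in> space (paths G) \<Longrightarrow> k \<le> 0 \<Longrightarrow> \<eta> k \<in> carrier G"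
  by (auto simp: space_paths)

lemma coordinate_measurable: "k \<le> 0 \<Longrightarrow> (\<lambda>\<eta>. \<eta> k) \<in> paths G \<rightarrow>\<^sub>M count_space (carrier G)"
  unfolding paths_def by (rule measurable_component_singleton) simp

lemma space_past_eta [simp]: "space (past_eta G k) = space (paths G)"
  by (simp add: past_eta_def past_def space_measure_of_conv)

lemma space_past_noise [simp]: "space (past_noise G k) = space (paths G)"
  by (simp add: past_noise_def past_def space_measure_of_conv)

lemma sets_past_eta:
  "sets (past_eta G k) = sigma_sets (space (paths G))
     {(\<lambda>\<eta>. \<eta> j) -` A \<inter> space (paths G) | j A. j \<le> k \<and> A \<subseteq> carrier G}"
  unfolding past_eta_def past_def by (rule sets_measure_of) auto

lemma sets_past_noise:
  "sets (past_noise G k) = sigma_sets (space (paths G))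
     {noise G j -` A \<inter> space (paths G) | j A. j \<le> k \<and> A \<subseteq> carrier G}"
  unfolding past_noise_def past_def by (rule sets_measure_of) auto

lemma coordinate_event_past:
  assumes "j \<le> k" "k \<le> 0" shows "{\<eta> \<in> space (paths G). \<eta> j \<in> A} \<in> sets (past_eta G k)"
proof -
  have "{\<eta> \<in> space (paths G). \<eta> j \<in> A} = (\<lambda>\<eta>. \<eta> j) -` (A \<inter> carrier G) \<inter> space (paths G)"
    using assms coordinate_in_carrier[of _ G j] by auto
  then show ?thesis
    unfolding sets_past_eta using assms by (intro sigma_sets.Basic) blast
qed

lemma past_eta_subset: "k \<le> 0 \<Longrightarrow> sets (past_eta G k) \<subseteq> sets (paths G)"
  unfolding sets_past_eta
  by (intro sets.sigma_sets_subset)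
     (auto intro!: measurable_sets[OF coordinate_measurable])

lemma coordinate_event:
  assumes "j \<le> 0" shows "{\<eta> \<in> space (paths G). \<eta> j \<in> A} \<in> sets (paths G)"
  using coordinate_event_past[of j j G A] past_eta_subset[of j G] assms by auto

lemma past_eta_mono: "k \<le> l \<Longrightarrow> sets (past_eta G k) \<subseteq> sets (past_eta G l)"
  unfolding sets_past_eta by (intro sigma_sets_mono') force

section \<open>Solutions with noise uniform on a subgroup\<close>

locale subgroup_noise = group G for G (structure) +
  fixes H :: "'a set" and \<mu> :: "int \<Rightarrow> 'a measure"
  assumes finite_carrier: "finite (carrier G)"
    and subgroup_H: "subgroup H G"
    and noise_law: "k \<le> 0 \<Longrightarrow> \<mu> k = uniform_measure (count_space (carrier G)) H"
begin

definition weight :: "'a set \<Rightarrow> real" where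
  "weight A = card (A \<inter> H) / card H"

lemma H_subset: "H \<subseteq> carrier G" and one_in_H: "\<one> \<in> H"
  using subgroup_H by (auto simp: subgroup.subset subgroup.one_closed)

lemma finite_H: "finite H"
  using H_subset finite_carrier finite_subset by blast

lemma card_H_pos: "card H > 0"
  using finite_H one_in_H by (auto simp: card_gt_0_iff)

lemma H_closed: "x \<in> H \<Longrightarrow> y \<in> H \<Longrightarrow> x \<otimes> y \<in> H" "x \<in> H \<Longrightarrow> inv x \<in> H"
  using subgroup_H by (auto simp: subgroup.m_closed subgroup.m_inv_closed)

abbreviation u :: "'a measure" where "u \<equiv> uniform_measure (count_space (carrier G)) H"

lemma prob_space_u: "prob_space u"
  using H_subset finite_H one_in_H finite_carrier
  by (intro prob_space_uniform_measure) (auto simp: emeasure_count_space)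

lemma measure_u:
  assumes "A \<subseteq> carrier G" shows "measure u A = weight A"
proof -
  have "emeasure (count_space (carrier G)) H = card H"
    using H_subset finite_H by (rule emeasure_count_space_finite)
  moreover have "emeasure (count_space (carrier G)) (H \<inter> A) = card (A \<inter> H)"
    using H_subset finite_H by (subst emeasure_count_space_finite) (auto simp: Int_commute)
  ultimately show ?thesis
    using assms card_H_pos H_subset
    by (subst measure_uniform_measure) (auto simp: weight_def measure_def)
qed

lemma in_carrier [simp]: "x \<in> H \<Longrightarrow> x \<in> carrier G"
  using H_subset by auto

lemma noise_in_carrier:
  "\<eta> \<in> space (paths G) \<Longrightarrow> k \<le> 0 \<Longrightarrow> noise G k \<eta> \<in> carrier G"
  by (simp add: noise_def coordinate_in_carrier)

lemma noise_measurable: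
  assumes "k \<le> 0" shows "noise G k \<in> paths G \<rightarrow>\<^sub>M count_space (carrier G)"
proof (rule measurable_count_space_eq2[THEN iffD2, OF finite_carrier], intro conjI ballI)
  show "noise G k \<in> space (paths G) \<rightarrow> carrier G"
    using noise_in_carrier assms by auto
  fix a assume a: "a \<in> carrier G"
  have "noise G k -` {a} \<inter> space (paths G) =
    (\<Union>y\<in>carrier G. {\<eta> \<in> space (paths G). \<eta> (k - 1) \<in> {y}} \<inter> {\<eta> \<in> space (paths G). \<eta> k \<in> {y \<otimes> a}})"
    using a assms by (auto simp: noise_def coordinate_in_carrier m_assoc[symmetric] inv_solve_left)
  also have "\<dots> \<in> sets (paths G)"
    using assms finite_carrier by (intro sets.finite_UN sets.Int coordinate_event) auto
  finally show "noise G k -` {a} \<inter> space (paths G) \<in> sets (paths G)" .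
qed

lemma noise_event:
  assumes "k \<le> 0" "A \<subseteq> carrier G" shows "{\<eta> \<in> space (paths G). noise G k \<eta> \<in> A} \<in> sets (paths G)"
  using measurable_sets[OF noise_measurable[OF assms(1)], of A] assms(2)
  by (simp add: vimage_def Collect_conj_eq Int_commute)

text \<open>Independence and the law of the noise are merged into one product formula.  The law is the case
  where \<open>B\<close> is the whole path space.\<close>

lemma solutions_iff:
  "P \<in> solutions G \<mu> \<longleftrightarrow> prob_space P \<and> sets P = sets (paths G) \<and>
     (\<forall>k\<le>0. \<forall>A B. A \<subseteq> carrier G \<longrightarrow> B \<in> sets (past_eta G (k - 1)) \<longrightarrow>
        measure P ({\<eta> \<in> space (paths G). noise G k \<eta> \<in> A} \<inter> B) = weight A * measure P B)"
proof (cases "prob_space P \<and> sets P = sets (paths G)")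
  case True
  then have sets_P: "sets P = sets (paths G)" by simp
  from sets_P have space_P: "space P = space (paths G)" by (rule sets_eq_imp_space_eq)
  interpret prob_space P using True by simp
  have vimage: "sets (vimage_algebra (space P) (noise G k) (count_space (carrier G))) =
      {{\<eta> \<in> space (paths G). noise G k \<eta> \<in> A} | A. A \<subseteq> carrier G}" if "k \<le> 0" for k
    using that noise_in_carrier
    by (subst sets_vimage_algebra2) (auto simp: space_P vimage_def Int_def conj_commute)
  have meas: "noise G k \<in> P \<rightarrow>\<^sub>M count_space (carrier G)" if "k \<le> 0" for k
    using noise_measurable[OF that] measurable_cong_sets[OF sets_P refl] by blast
  have law: "distr P (count_space (carrier G)) (noise G k) = \<mu> k \<longleftrightarrow>
      (\<forall>A\<subseteq>carrier G. measure P {\<eta> \<in> space (paths G). noise G k \<eta> \<in> A} = weight A)"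
    if k: "k \<le> 0" for k
  proof -
    interpret D: prob_space "distr P (count_space (carrier G)) (noise G k)"
      by (rule prob_space_distr[OF meas[OF k]])
    interpret U: prob_space u by (rule prob_space_u)
    have D: "measure (distr P (count_space (carrier G)) (noise G k)) A =
        measure P {\<eta> \<in> space (paths G). noise G k \<eta> \<in> A}" if "A \<subseteq> carrier G" for A
      using that by (subst measure_distr[OF meas[OF k]])
        (auto simp: space_P vimage_def Int_def conj_commute)
    show ?thesis
      unfolding noise_law[OF k]
    proof
      assume eq: "distr P (count_space (carrier G)) (noise G k) = u"
      show "\<forall>A\<subseteq>carrier G. measure P {\<eta> \<in> space (paths G). noise G k \<eta> \<in> A} = weight A"
        using D measure_u by (simp add: eq)
    next
      assume "\<forall>A\<subseteq>carrier G. measure P {\<eta> \<in> space (paths G). noise G k \<eta> \<in> A} = weight A"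
      then show "distr P (count_space (carrier G)) (noise G k) = u"
        by (intro measure_eqI) (auto simp: D.emeasure_eq_measure U.emeasure_eq_measure D measure_u)
    qed
  qed
  have "indep_set (sets (vimage_algebra (space P) (noise G k) (count_space (carrier G))))
          (sets (past_eta G (k - 1))) \<and> distr P (count_space (carrier G)) (noise G k) = \<mu> k \<longleftrightarrow>
       (\<forall>A B. A \<subseteq> carrier G \<longrightarrow> B \<in> sets (past_eta G (k - 1)) \<longrightarrow>
        measure P ({\<eta> \<in> space (paths G). noise G k \<eta> \<in> A} \<inter> B) = weight A * measure P B)"
    (is "?L \<longleftrightarrow> ?R") if k: "k \<le> 0" for k
  proof
    assume ?L
    then have indep: "indep_set {{\<eta> \<in> space (paths G). noise G k \<eta> \<in> A} | A. A \<subseteq> carrier G}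
        (sets (past_eta G (k - 1)))"
      and law': "\<forall>A\<subseteq>carrier G. measure P {\<eta> \<in> space (paths G). noise G k \<eta> \<in> A} = weight A"
      unfolding law[OF k] vimage[OF k] by blast+
    show ?R
    proof (intro allI impI)
      fix A B assume A: "A \<subseteq> carrier G" and B: "B \<in> sets (past_eta G (k - 1))"
      from A have "{\<eta> \<in> space (paths G). noise G k \<eta> \<in> A} \<in>
          {{\<eta> \<in> space (paths G). noise G k \<eta> \<in> A} | A. A \<subseteq> carrier G}"
        by blast
      from indep_setD[OF indep this B] law' A
      show "measure P ({\<eta> \<in> space (paths G). noise G k \<eta> \<in> A} \<inter> B) = weight A * measure P B"
        by simp
    qed
  next
    assume R: ?R
    have prob: "measure P {\<eta> \<in> space (paths G). noise G k \<eta> \<in> A} = weight A"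
      if "A \<subseteq> carrier G" for A
    proof -
      have "space (paths G) \<in> sets (past_eta G (k - 1))"
        using sets.top[of "past_eta G (k - 1)"] by simp
      then have "measure P ({\<eta> \<in> space (paths G). noise G k \<eta> \<in> A} \<inter> space (paths G)) =
        weight A * measure P (space (paths G))"
        using R that by blast
      moreover have "measure P (space (paths G)) = 1" using prob_space space_P by simp
      ultimately show ?thesis by (simp add: Int_def conj_commute)
    qed
    show ?L
      unfolding law[OF k] indep_sets2_eq vimage[OF k] sets_P
    proof (intro conjI ballI)
      show "{{\<eta> \<in> space (paths G). noise G k \<eta> \<in> A} | A. A \<subseteq> carrier G} \<subseteq> sets (paths G)"
        using noise_event[OF k] by blast
      show "sets (past_eta G (k - 1)) \<subseteq> sets (paths G)"
        using k by (intro past_eta_subset) simp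
      show "\<forall>A\<subseteq>carrier G. measure P {\<eta> \<in> space (paths G). noise G k \<eta> \<in> A} = weight A"
        using prob by blast
      fix a b assume a: "a \<in> {{\<eta> \<in> space (paths G). noise G k \<eta> \<in> A} | A. A \<subseteq> carrier G}"
        and b: "b \<in> sets (past_eta G (k - 1))"
      from a obtain A where A: "A \<subseteq> carrier G" "a = {\<eta> \<in> space (paths G). noise G k \<eta> \<in> A}" by blast
      then show "measure P (a \<inter> b) = measure P a * measure P b"
        using R[rule_format, OF A(1) b] prob[OF A(1)] by simp
    qed
  qed
  then show ?thesis using True unfolding solutions_def by auto
qed (auto simp: solutions_def)

lemma solutionD:
  assumes "P \<in> solutions G \<mu>"
  shows "prob_space P" "sets P = sets (paths G)" "space P = space (paths G)"
    and "k \<le> 0 \<Longrightarrow> A \<subseteq> carrier G \<Longrightarrow> B \<in> sets (past_eta G (k - 1)) \<Longrightarrow>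
        measure P ({\<eta> \<in> space (paths G). noise G k \<eta> \<in> A} \<inter> B) = weight A * measure P B"
  using assms sets_eq_imp_space_eq[of P "paths G"] unfolding solutions_iff by blast+

text \<open>The uniform law gives mass one to \<open>H\<close>, and there are only countably many times.\<close>

lemma noise_in_H:
  assumes P: "P \<in> solutions G \<mu>"
  shows "AE \<eta> in P. \<forall>k\<le>0. noise G k \<eta> \<in> H"
proof -
  interpret prob_space P using solutionD[OF P] by simp
  note P_D = solutionD[OF P]
  have "AE \<eta> in P. k \<le> 0 \<longrightarrow> noise G k \<eta> \<in> H" for k
  proof (cases "k \<le> 0")
    case k: True
    have "space (paths G) \<in> sets (past_eta G (k - 1))"
      using sets.top[of "past_eta G (k - 1)"] by simp
    from P_D(4)[OF k H_subset this]
    have "prob ({\<eta> \<in> space (paths G). noise G k \<eta> \<in> H} \<inter> space (paths G)) = 1"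
      using card_H_pos prob_space P_D(3) by (simp add: weight_def)
    then have "prob {\<eta> \<in> space P. noise G k \<eta> \<in> H} = 1"
      by (simp add: P_D(3) Int_def conj_commute)
    then have "AE \<eta> in P. noise G k \<eta> \<in> H"
      using noise_event[OF k H_subset] P_D(2,3) by (subst prob_Collect_eq_1[symmetric]) simp_all
    then show ?thesis by simp
  qed simp
  then show ?thesis by (simp add: AE_all_countable)
qed

text \<open>The unions of left cosets of \<open>H\<close>: a path whose noise stays in \<open>H\<close> can neither enter nor leave
  such a set.\<close>

definition right_invariant :: "'a set \<Rightarrow> bool" where
  "right_invariant S \<longleftrightarrow> S \<subseteq> carrier G \<and> (\<forall>s\<in>S. \<forall>h\<in>H. s \<otimes> h \<in> S)"

lemma right_invariant_coset: "g \<in> carrier G \<Longrightarrow> right_invariant (g <# H)"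
  unfolding right_invariant_def l_coset_def using H_closed(1) by (fastforce simp: m_assoc)

lemma coset_constant:
  assumes S: "right_invariant S" and \<eta>: "\<eta> \<in> space (paths G)"
    and noise: "\<forall>k\<le>0. noise G k \<eta> \<in> H" and k: "k \<le> 0"
  shows "\<eta> k \<in> S \<longleftrightarrow> \<eta> 0 \<in> S"
  using k
proof (induction k rule: int_le_induct)
  case (step i)
  have car: "\<eta> i \<in> carrier G" "\<eta> (i - 1) \<in> carrier G"
    using step.hyps \<eta> by (auto intro: coordinate_in_carrier)
  have h: "noise G i \<eta> \<in> H" using noise step.hyps by blast
  have forth: "\<eta> i = \<eta> (i - 1) \<otimes> noise G i \<eta>"
    using car by (simp add: noise_def m_assoc[symmetric])
  have backward: "\<eta> (i - 1) = \<eta> i \<otimes> inv (noise G i \<eta>)"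
    using inv_solve_right[OF car(2,1) in_carrier[OF h]] forth by blast
  have "\<eta> (i - 1) \<in> S \<longleftrightarrow> \<eta> i \<in> S"
    using S h H_closed(2)[OF h] forth backward unfolding right_invariant_def by metis
  then show ?case using step.IH by simp
qed simp

text \<open>This lets an event about the coset at time \<open>0\<close> be moved to any earlier time, where it belongs to the
  past of a given noise variable.\<close>

lemma prob_coset_constant:
  assumes P: "P \<in> solutions G \<mu>" and S: "right_invariant S" and k: "k \<le> 0"
    and B: "B \<in> sets (paths G)"
  shows "measure P (B \<inter> {\<eta> \<in> space (paths G). \<eta> k \<in> S}) =
    measure P (B \<inter> {\<eta> \<in> space (paths G). \<eta> 0 \<in> S})"
proof (rule finite_measure.finite_measure_eq_AE)
  note P_D = solutionD[OF P]
  show "finite_measure P" using P_D(1) by (simp add: prob_space_def)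
  show "AE \<eta> in P. (\<eta> \<in> B \<inter> {\<eta> \<in> space (paths G). \<eta> k \<in> S}) =
      (\<eta> \<in> B \<inter> {\<eta> \<in> space (paths G). \<eta> 0 \<in> S})"
    using noise_in_H[OF P] AE_space
  proof eventually_elim
    case (elim \<eta>)
    then show ?case using coset_constant[OF S _ elim(1) k] P_D(3) by auto
  qed
qed (use k B coordinate_event in \<open>auto simp: solutionD[OF P]\<close>)

section \<open>A solution is determined by the law of its coset\<close>

text \<open>To arrive at \<open>y\<close> the path must come from some \<open>z\<close> in the coset of \<open>y\<close>, and then the noise must be the
  one element \<open>inv z \<otimes> y\<close> of \<open>H\<close>, which has probability \<open>1 / card H\<close> whatever \<open>z\<close> is.  This is
  the step in which the position inside the coset is forgotten.\<close>

lemma prob_extend: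
  assumes P: "P \<in> solutions G \<mu>" and k: "k \<le> 0" and y: "y \<in> carrier G"
    and B: "B \<in> sets (past_eta G (k - 1))"
  shows "measure P (B \<inter> {\<eta> \<in> space (paths G). \<eta> k \<in> {y}}) =
    measure P (B \<inter> {\<eta> \<in> space (paths G). \<eta> (k - 1) \<in> y <# H}) / card H"
proof -
  note P_D = solutionD[OF P]
  interpret prob_space P using P_D(1) by simp
  let ?E = "\<lambda>j A. {\<eta> \<in> space (paths G). \<eta> j \<in> A}"
  have B': "B \<in> sets (paths G)" "B \<subseteq> space (paths G)"
    using B past_eta_subset[of "k - 1" G] k sets.sets_into_space by auto
  have past: "?E (k - 1) A \<in> sets (past_eta G (k - 1))" for A
    using k by (intro coordinate_event_past) auto
  have point: "{\<eta> \<in> space (paths G). \<eta> (k - 1) = z} \<in> sets (paths G)" for z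
    using coordinate_event[of "k - 1" G "{z}"] k by simp
  have noise_point: "{\<eta> \<in> space (paths G). noise G k \<eta> = a} \<in> sets (paths G)" if "a \<in> carrier G" for a
    using noise_event[OF k, of "{a}"] that by simp
  have weight: "weight {inv z \<otimes> y} = (if z \<in> y <# H then 1 / card H else 0)"
    if z: "z \<in> carrier G" for z
  proof -
    have "z \<in> y <# H \<longleftrightarrow> inv z \<otimes> y \<in> H"
    proof
      assume "z \<in> y <# H"
      then obtain h where h: "h \<in> H" "z = y \<otimes> h" by (auto simp: l_coset_def)
      then have "inv z \<otimes> y = inv h" using y by (simp add: inv_mult_group m_assoc)
      then show "inv z \<otimes> y \<in> H" using H_closed(2) h by simp
    next
      assume "inv z \<otimes> y \<in> H"
      then have "inv (inv z \<otimes> y) \<in> H" by (rule H_closed(2))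
      moreover have "z = y \<otimes> inv (inv z \<otimes> y)"
        using y z by (simp add: inv_mult_group m_assoc[symmetric])
      ultimately show "z \<in> y <# H" by (auto simp: l_coset_def)
    qed
    then show ?thesis by (auto simp: weight_def)
  qed
  have "B \<inter> ?E k {y} = (\<Union>z\<in>carrier G. {\<eta> \<in> space (paths G). noise G k \<eta> \<in> {inv z \<otimes> y}} \<inter> (B \<inter> ?E (k - 1) {z}))"
    using y k B'(2) by (auto simp: noise_def coordinate_in_carrier)
  then have "prob (B \<inter> ?E k {y}) =
      (\<Sum>z\<in>carrier G. prob ({\<eta> \<in> space (paths G). noise G k \<eta> \<in> {inv z \<otimes> y}} \<inter> (B \<inter> ?E (k - 1) {z})))"
    using finite_carrier B' noise_point point y
    by (simp only:, intro finite_measure_finite_Union)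
       (auto simp: P_D disjoint_family_on_def intro!: sets.Int)
  also have "\<dots> = (\<Sum>z\<in>carrier G. weight {inv z \<otimes> y} * prob (B \<inter> ?E (k - 1) {z}))"
    using y B past by (intro sum.cong refl P_D(4) k sets.Int past) auto
  also have "\<dots> = (\<Sum>z\<in>carrier G. (if z \<in> y <# H then prob (B \<inter> ?E (k - 1) {z}) else 0)) / card H"
    unfolding sum_divide_distrib by (intro sum.cong) (simp_all add: weight)
  also have "(\<Sum>z\<in>carrier G. (if z \<in> y <# H then prob (B \<inter> ?E (k - 1) {z}) else 0)) =
      (\<Sum>z\<in>y <# H. prob (B \<inter> ?E (k - 1) {z}))"
    using finite_carrier y l_coset_subset_G[OF H_subset y]
    by (simp add: sum.inter_restrict[symmetric] Int_absorb1)
  also have "\<dots> = prob (\<Union>z\<in>y <# H. B \<inter> ?E (k - 1) {z})"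
    using B' point l_coset_subset_G[OF H_subset y]
    by (intro finite_measure_finite_Union[symmetric])
       (auto simp: P_D disjoint_family_on_def finite_subset[OF _ finite_carrier] intro!: sets.Int)
  also have "(\<Union>z\<in>y <# H. B \<inter> ?E (k - 1) {z}) = B \<inter> ?E (k - 1) (y <# H)"
    by auto
  finally show ?thesis .
qed

text \<open>A window of \<open>n + 1\<close> consecutive coordinates, given by its first time and its length so that
  it can be extended to the right by induction on \<open>n\<close>.\<close>

abbreviation cylinder :: "int \<Rightarrow> nat \<Rightarrow> (int \<Rightarrow> 'a) \<Rightarrow> (int \<Rightarrow> 'a) set" where
  "cylinder m n x \<equiv> {\<eta> \<in> space (paths G). \<forall>j\<in>{m..m + int n}. \<eta> j = x j}"

lemma cylinder_Suc:
  "cylinder m (Suc n) x = cylinder m n x \<inter> {\<eta> \<in> space (paths G). \<eta> (m + int (Suc n)) \<in> {x (m + int (Suc n))}}"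
proof -
  have "{m..m + int (Suc n)} = insert (m + int (Suc n)) {m..m + int n}" by auto
  then show ?thesis by auto
qed

lemma cylinder_past: "m + int n \<le> 0 \<Longrightarrow> cylinder m n x \<in> sets (past_eta G (m + int n))"
proof (induction n)
  case 0
  then show ?case using coordinate_event_past[of m m G "{x m}"] by simp
next
  case (Suc n)
  have "cylinder m n x \<in> sets (past_eta G (m + int (Suc n)))"
    using Suc past_eta_mono[of "m + int n" "m + int (Suc n)" G] by auto
  then show ?case
    unfolding cylinder_Suc using Suc.prems by (intro sets.Int coordinate_event_past) auto
qed

text \<open>By \<open>prob_extend\<close>, enlarging the window by one coordinate multiplies its probability by
  \<open>1 / card H\<close> or by \<open>0\<close>, a factor that does not depend on the solution.  Only the first coordinate
  depends on it, through the probability of its coset.\<close>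

lemma prob_cylinder_eq:
  assumes P: "P \<in> solutions G \<mu>" and Q: "Q \<in> solutions G \<mu>"
    and eq: "\<And>y. y \<in> carrier G \<Longrightarrow> measure P {\<eta> \<in> space (paths G). \<eta> 0 \<in> y <# H} =
      measure Q {\<eta> \<in> space (paths G). \<eta> 0 \<in> y <# H}"
    and x: "\<And>j. j \<in> {m..m + int n} \<Longrightarrow> x j \<in> carrier G" and n: "m + int n \<le> 0"
  shows "measure P (cylinder m n x) = measure Q (cylinder m n x)"
  using x n
proof (induction n)
  case 0
  have top: "space (paths G) \<in> sets (past_eta G (m - 1))"
    using sets.top[of "past_eta G (m - 1)"] by simp
  have "measure R (cylinder m 0 x) = measure R {\<eta> \<in> space (paths G). \<eta> 0 \<in> x m <# H} / card H"
    if R: "R \<in> solutions G \<mu>" for R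
    using prob_extend[OF R _ _ top, of "x m"]
      prob_coset_constant[OF R right_invariant_coset[of "x m"], of "m - 1" "space (paths G)"]
      0 sets.top[of "paths G"]
    by (simp add: Int_def conj_commute cong: conj_cong)
  then show ?case using P Q eq 0 by simp
next
  case (Suc n)
  let ?k = "m + int (Suc n)"
  have "measure R (cylinder m (Suc n) x) =
      (if x (m + int n) \<in> x ?k <# H then measure R (cylinder m n x) else 0) / card H"
    if R: "R \<in> solutions G \<mu>" for R
  proof -
    have "measure R (cylinder m (Suc n) x) =
      measure R (cylinder m n x \<inter> {\<eta> \<in> space (paths G). \<eta> (m + int n) \<in> x ?k <# H}) / card H"
      using prob_extend[OF R, of ?k "x ?k" "cylinder m n x"] cylinder_past[of m n x] Suc.prems
      unfolding cylinder_Suc by simp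
    also have "cylinder m n x \<inter> {\<eta> \<in> space (paths G). \<eta> (m + int n) \<in> x ?k <# H} =
      (if x (m + int n) \<in> x ?k <# H then cylinder m n x else {})" by auto
    finally show ?thesis by simp
  qed
  then show ?case using P Q Suc by simp
qed

text \<open>Every finite-dimensional box is a finite disjoint union of windows, so the agreement on windows
  determines the measure.\<close>

lemma solution_eqI:
  assumes P: "P \<in> solutions G \<mu>" and Q: "Q \<in> solutions G \<mu>"
    and eq: "\<And>y. y \<in> carrier G \<Longrightarrow> measure P {\<eta> \<in> space (paths G). \<eta> 0 \<in> y <# H} =
      measure Q {\<eta> \<in> space (paths G). \<eta> 0 \<in> y <# H}"
  shows "P = Q"
proof (rule measure_eqI_PiM_infinite)
  note P_D = solutionD[OF P] and Q_D = solutionD[OF Q]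
  interpret P: prob_space P by (rule P_D)
  interpret Q: prob_space Q by (rule Q_D)
  show "sets P = sets (PiM {..0::int} (\<lambda>_. count_space (carrier G)))"
    "sets Q = sets (PiM {..0::int} (\<lambda>_. count_space (carrier G)))"
    using P_D(2) Q_D(2) by (simp_all add: paths_def)
  show "finite_measure P" by (rule P.finite_measure_axioms)
  fix A :: "int \<Rightarrow> 'a set" and J :: "int set"
  assume J: "finite J" "J \<subseteq> {..0}" and A: "\<And>i. i \<in> J \<Longrightarrow> A i \<in> sets (count_space (carrier G))"
  define n where "n = nat (- Min (insert 0 J))"
  have n: "J \<subseteq> {- int n..0}"
    proof
    fix i assume "i \<in> J"
    with J have "Min (insert 0 J) \<le> i" "i \<le> 0" by auto
    then show "i \<in> {- int n..0}" unfolding n_def by (simp add: int_nat_eq del: minus_Min_eq_Max)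
  qed
  define W where "W = {- int n..0}"
  define A' where "A' = (\<lambda>i. if i \<in> J then A i else carrier G)"
  have A': "A' i \<subseteq> carrier G" for i using A by (auto simp: A'_def)
  let ?X = "PiE W A'"
  have fin: "finite ?X"
    using A' finite_carrier by (intro finite_PiE) (auto simp: W_def intro: finite_subset)
  have emb: "prod_emb {..0} (\<lambda>_. count_space (carrier G)) J (Pi\<^sub>E J A) = (\<Union>x\<in>?X. cylinder (- int n) n x)"
  proof (intro subset_antisym subsetI)
    fix \<eta> assume "\<eta> \<in> prod_emb {..0} (\<lambda>_. count_space (carrier G)) J (Pi\<^sub>E J A)"
    then have "\<eta> \<in> space (paths G)" "\<forall>j\<in>J. \<eta> j \<in> A j"
      by (auto simp: prod_emb_def space_paths)
    then show "\<eta> \<in> (\<Union>x\<in>?X. cylinder (- int n) n x)"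
      by (intro UN_I[of "restrict \<eta> W"]) (auto simp: W_def A'_def coordinate_in_carrier)
  next
    fix \<eta> assume "\<eta> \<in> (\<Union>x\<in>?X. cylinder (- int n) n x)"
    then obtain x where "x \<in> ?X" "\<eta> \<in> space (paths G)" "\<forall>j\<in>W. \<eta> j = x j" by (auto simp: W_def)
    then have "\<forall>j\<in>W. \<eta> j \<in> A' j" by auto
    then have "\<forall>j\<in>J. \<eta> j \<in> A j" using n unfolding W_def A'_def by (metis subsetD)
    with \<open>\<eta> \<in> space (paths G)\<close> show "\<eta> \<in> prod_emb {..0} (\<lambda>_. count_space (carrier G)) J (Pi\<^sub>E J A)"
      by (auto simp: prod_emb_def space_paths)
  qed
  have coord: "x j \<in> carrier G" if "x \<in> ?X" "j \<in> W" for x j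
    using PiE_mem[OF that] A' by blast
  have disj: "disjoint_family_on (cylinder (- int n) n) ?X"
  proof (unfold disjoint_family_on_def, intro ballI impI)
    fix x y assume xy: "x \<in> ?X" "y \<in> ?X" "x \<noteq> y"
    have "x = y" if "\<eta> \<in> cylinder (- int n) n x \<inter> cylinder (- int n) n y" for \<eta>
      using xy(1,2)
    proof (rule PiE_ext)
      fix j assume "j \<in> W"
      then show "x j = y j" using that by (auto simp: W_def)
    qed
    then show "cylinder (- int n) n x \<inter> cylinder (- int n) n y = {}" using xy(3) by blast
  qed
  have sets: "cylinder (- int n) n x \<in> sets (paths G)" for x
    using cylinder_past[of "- int n" n x] past_eta_subset[of 0 G] by auto
  have "measure P (\<Union>x\<in>?X. cylinder (- int n) n x) = (\<Sum>x\<in>?X. measure P (cylinder (- int n) n x))"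
    using fin disj sets by (intro P.finite_measure_finite_Union) (auto simp: P_D)
  also have "\<dots> = (\<Sum>x\<in>?X. measure Q (cylinder (- int n) n x))"
    using coord by (intro sum.cong refl prob_cylinder_eq[OF P Q eq]) (auto simp: W_def)
  also have "\<dots> = measure Q (\<Union>x\<in>?X. cylinder (- int n) n x)"
    using fin disj sets by (intro Q.finite_measure_finite_Union[symmetric]) (auto simp: Q_D)
  finally show "emeasure P (prod_emb {..0} (\<lambda>_. count_space (carrier G)) J (Pi\<^sub>E J A)) =
      emeasure Q (prod_emb {..0} (\<lambda>_. count_space (carrier G)) J (Pi\<^sub>E J A))"
    by (simp add: emb P.emeasure_eq_measure Q.emeasure_eq_measure)
qed

lemma measure_conditioned:
  assumes P: "P \<in> solutions G \<mu>" and E: "E \<in> sets (paths G)" "measure P E > 0"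
    and A: "A \<in> sets (paths G)"
  shows "measure (uniform_measure P E) A = measure P (A \<inter> E) / measure P E"
proof -
  interpret prob_space P using solutionD(1)[OF P] .
  show ?thesis
    using E A by (subst measure_uniform_measure)
      (auto simp: emeasure_eq_measure solutionD(2)[OF P] Int_commute)
qed

text \<open>The event that is conditioned on agrees almost surely with the same event at time \<open>k - 1\<close>, which lies
  in the past and hence does not disturb the independence of the noise at time \<open>k\<close>.\<close>

lemma conditioned_solution:
  assumes P: "P \<in> solutions G \<mu>" and S: "right_invariant S"
    and pos: "measure P {\<eta> \<in> space (paths G). \<eta> 0 \<in> S} > 0"
  shows "uniform_measure P {\<eta> \<in> space (paths G). \<eta> 0 \<in> S} \<in> solutions G \<mu>"
  unfolding solutions_iff
proof (intro conjI allI impI)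
  interpret prob_space P using solutionD(1)[OF P] .
  let ?E = "\<lambda>k. {\<eta> \<in> space (paths G). \<eta> k \<in> S}"
  have E: "?E 0 \<in> sets (paths G)" by (intro coordinate_event) simp
  show "prob_space (uniform_measure P (?E 0))"
    using pos by (intro prob_space_uniform_measure) (auto simp: emeasure_eq_measure)
  show "sets (uniform_measure P (?E 0)) = sets (paths G)"
    by (simp add: solutionD(2)[OF P])
  fix k :: int and A B
  assume k: "k \<le> 0" and A: "A \<subseteq> carrier G" and B: "B \<in> sets (past_eta G (k - 1))"
  let ?A = "{\<eta> \<in> space (paths G). noise G k \<eta> \<in> A}"
  have B': "B \<in> sets (paths G)" using B past_eta_subset[of "k - 1" G] k by auto
  have A': "?A \<in> sets (paths G)" using noise_event[OF k A] .
  have swap: "prob (C \<inter> ?E 0) = prob (C \<inter> ?E (k - 1))" if "C \<in> sets (paths G)" for C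
    using prob_coset_constant[OF P S _ that, of "k - 1"] k by simp
  have "prob (?A \<inter> B \<inter> ?E 0) = prob (?A \<inter> (B \<inter> ?E (k - 1)))"
    using swap[OF sets.Int[OF A' B']] by (simp only: Int_assoc)
  also have "\<dots> = weight A * prob (B \<inter> ?E (k - 1))"
    using B k by (intro solutionD(4)[OF P k A] sets.Int coordinate_event_past) auto
  also have "\<dots> = weight A * prob (B \<inter> ?E 0)"
    using swap B' by simp
  finally show "measure (uniform_measure P (?E 0)) (?A \<inter> B) =
      weight A * measure (uniform_measure P (?E 0)) B"
    using measure_conditioned[OF P E pos] A' B' by (simp add: sets.Int)
qed

section \<open>The independent uniform path\<close>

definition iid :: "(int \<Rightarrow> 'a) measure" where
  "iid = PiM {..0} (\<lambda>_. u)"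

lemma sets_iid: "sets iid = sets (paths G)" and space_iid: "space iid = space (paths G)"
  unfolding iid_def paths_def by (intro sets_PiM_cong, simp_all add: space_PiM)

lemma prob_space_iid: "prob_space iid"
  unfolding iid_def by (intro prob_space_PiM prob_space_u)

lemma coordinate_law_iid:
  assumes k: "k \<le> 0" shows "distr iid (count_space (carrier G)) (\<lambda>\<eta>. \<eta> k) = u"
proof -
  have "distr (PiM {..0} (\<lambda>_. u)) u (\<lambda>\<eta>. \<eta> k) = u"
    using k prob_space_u by (intro distr_PiM_component) auto
  also have "distr (PiM {..0} (\<lambda>_. u)) u (\<lambda>\<eta>. \<eta> k) = distr iid (count_space (carrier G)) (\<lambda>\<eta>. \<eta> k)"
    unfolding iid_def by (intro distr_cong) auto
  finally show ?thesis .
qed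

lemma prob_coordinate_iid:
  assumes k: "k \<le> 0" and A: "A \<subseteq> carrier G"
  shows "measure iid {\<eta> \<in> space (paths G). \<eta> k \<in> A} = weight A"
proof -
  have "(\<lambda>\<eta>. \<eta> k) \<in> iid \<rightarrow>\<^sub>M count_space (carrier G)"
    using coordinate_measurable[OF k] measurable_cong_sets[OF sets_iid refl] by blast
  then have "measure (distr iid (count_space (carrier G)) (\<lambda>\<eta>. \<eta> k)) A =
      measure iid ((\<lambda>\<eta>. \<eta> k) -` A \<inter> space iid)"
    using A by (intro measure_distr) auto
  also have "(\<lambda>\<eta>. \<eta> k) -` A \<inter> space iid = {\<eta> \<in> space (paths G). \<eta> k \<in> A}"
    by (auto simp: space_iid)
  finally show ?thesis
    using A by (simp add: coordinate_law_iid[OF k] measure_u)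
qed

lemma indep_coordinates_iid:
  "prob_space.indep_sets iid (\<lambda>j. {(\<lambda>\<eta>. \<eta> j) -` A \<inter> space (paths G) | A. A \<subseteq> carrier G}) {..0}"
proof -
  interpret prob_space iid by (rule prob_space_iid)
  interpret F: product_prob_space "\<lambda>_. u" "{..0::int}"
    by (simp add: product_prob_spaceI prob_space_u)
  have event: "(\<lambda>\<eta>. \<eta> j) -` A \<inter> space (paths G) = {\<eta> \<in> space (paths G). \<eta> j \<in> A}" for j A
    by auto
  show ?thesis
  proof (intro indep_setsI)
    fix J :: "int set" and B
    assume J: "J \<noteq> {}" "J \<subseteq> {..0}" "finite J"
      and B: "\<forall>j\<in>J. B j \<in> {(\<lambda>\<eta>. \<eta> j) -` A \<inter> space (paths G) | A. A \<subseteq> carrier G}"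
    from B have "\<forall>j\<in>J. \<exists>A. A \<subseteq> carrier G \<and> B j = {\<eta> \<in> space (paths G). \<eta> j \<in> A}"
      unfolding event by blast
    from bchoice[OF this] obtain A where A: "\<And>j. j \<in> J \<Longrightarrow> A j \<subseteq> carrier G"
        "\<And>j. j \<in> J \<Longrightarrow> B j = {\<eta> \<in> space (paths G). \<eta> j \<in> A j}"
      by blast
    have "(\<Inter>j\<in>J. B j) = prod_emb {..0} (\<lambda>_. u) J (Pi\<^sub>E J A)"
      using J A(2) by (auto simp: prod_emb_def space_paths PiE_iff extensional_def)
    moreover have "measure (PiM {..0} (\<lambda>_. u)) (prod_emb {..0} (\<lambda>_. u) J (Pi\<^sub>E J A)) = (\<Prod>j\<in>J. measure u (A j))"
      using J A(1) by (intro F.measure_PiM_emb) auto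
    ultimately show "prob (\<Inter>j\<in>J. B j) = (\<Prod>j\<in>J. prob (B j))"
      using J A by (simp add: iid_def[symmetric] measure_u prob_coordinate_iid subset_iff cong: prod.cong)
  qed (auto simp: event sets_iid intro!: coordinate_event)
qed

text \<open>Grouping the independent coordinates into the blocks \<open>{k}\<close> and \<open>{..k - 1}\<close>.\<close>

lemma indep_past_iid:
  assumes k: "k \<le> 0" and B: "B \<in> sets (past_eta G (k - 1))" and A: "A \<subseteq> carrier G"
  shows "measure iid ({\<eta> \<in> space (paths G). \<eta> k \<in> A} \<inter> B) = weight A * measure iid B"
proof -
  interpret prob_space iid by (rule prob_space_iid)
  let ?E = "\<lambda>j. {(\<lambda>\<eta>. \<eta> j) -` A \<inter> space (paths G) | A. A \<subseteq> carrier G}"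
  let ?I = "case_bool {k} {..k - 1}"
  have "indep_sets (\<lambda>b. sigma_sets (space iid) (\<Union>j\<in>?I b. ?E j)) UNIV"
  proof (rule indep_sets_collect_sigma)
    have "(\<Union>b. ?I b) \<subseteq> {..0}" using k by (auto simp: UNIV_bool)
    then show "indep_sets ?E (\<Union>b. ?I b)"
      using indep_coordinates_iid indep_sets_mono_index by blast
    show "disjoint_family ?I" by (auto simp: disjoint_family_on_def split: bool.split)
    show "Int_stable (?E j)" for j
    proof (rule Int_stableI)
      fix a b assume "a \<in> ?E j" "b \<in> ?E j"
      then obtain A B where "A \<subseteq> carrier G" "a = (\<lambda>\<eta>. \<eta> j) -` A \<inter> space (paths G)"
         "b = (\<lambda>\<eta>. \<eta> j) -` B \<inter> space (paths G)" by blast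
      then have "A \<inter> B \<subseteq> carrier G" "a \<inter> b = (\<lambda>\<eta>. \<eta> j) -` (A \<inter> B) \<inter> space (paths G)" by auto
      then show "a \<inter> b \<in> ?E j" by blast
    qed
  qed
  moreover have "{\<eta> \<in> space (paths G). \<eta> k \<in> A} \<in> sigma_sets (space iid) (\<Union>j\<in>{k}. ?E j)"
    using A by (intro sigma_sets.Basic) auto
  moreover have "(\<Union>j\<in>{..k - 1}. ?E j) =
      {(\<lambda>\<eta>. \<eta> j) -` A \<inter> space (paths G) | j A. j \<le> k - 1 \<and> A \<subseteq> carrier G}" by blast
  with B have "B \<in> sigma_sets (space iid) (\<Union>j\<in>{..k - 1}. ?E j)"
    unfolding sets_past_eta space_iid by simp
  ultimately have "prob ({\<eta> \<in> space (paths G). \<eta> k \<in> A} \<inter> B) = prob {\<eta> \<in> space (paths G). \<eta> k \<in> A} * prob B"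
    using indep_setsD[of _ UNIV UNIV "case_bool {\<eta> \<in> space (paths G). \<eta> k \<in> A} B"]
    by (auto simp: UNIV_bool Int_commute mult.commute split: bool.split)
  then show ?thesis using prob_coordinate_iid[OF k A] by simp
qed

lemma weight_translate:
  assumes h: "h \<in> H" and A: "A \<subseteq> carrier G"
  shows "weight (h <# A) = weight A"
proof -
  have "(h <# A) \<inter> H = (\<lambda>a. h \<otimes> a) ` (A \<inter> H)"
  proof (intro subset_antisym subsetI)
    fix x assume x: "x \<in> (h <# A) \<inter> H"
    then obtain a where a: "a \<in> A" "x = h \<otimes> a" by (auto simp: l_coset_def)
    then have "a = inv h \<otimes> x" using h A by (auto simp: m_assoc[symmetric])
    then have "a \<in> H" using h x H_closed by auto
    then show "x \<in> (\<lambda>a. h \<otimes> a) ` (A \<inter> H)" using a by auto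
  qed (use h H_closed in \<open>auto simp: l_coset_def\<close>)
  moreover have "inj_on (\<lambda>a. h \<otimes> a) (A \<inter> H)"
    using h A by (auto simp: inj_on_def)
  ultimately show ?thesis by (simp add: weight_def card_image)
qed

lemma iid_concentrated: "B \<in> sets (paths G) \<Longrightarrow> k \<le> 0 \<Longrightarrow>
  measure iid B = measure iid (B \<inter> {\<eta> \<in> space (paths G). \<eta> k \<in> H})"
proof -
  assume B: "B \<in> sets (paths G)" and k: "k \<le> 0"
  interpret prob_space iid by (rule prob_space_iid)
  let ?E = "{\<eta> \<in> space (paths G). \<eta> k \<in> H}"
  have E: "?E \<in> sets (paths G)" using k by (rule coordinate_event)
  have "prob ?E = 1"
    using prob_coordinate_iid[OF k H_subset] card_H_pos by (simp add: weight_def)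
  then have "prob (B - ?E) = 0"
    using prob_compl[of ?E] E B finite_measure_mono[of "B - ?E" "space iid - ?E"] sets.sets_into_space[OF B]
    by (force simp: sets_iid space_iid measure_le_0_iff)
  then show ?thesis
    using finite_measure_Union[of "B - ?E" "B \<inter> ?E"] B E
    by (simp add: sets_iid sets.Int Un_Diff_Int Diff_disjoint Int_commute inf_sup_aci)
qed

text \<open>Given \<open>\<eta> (k - 1) = h\<close> in \<open>H\<close>, the noise lies in \<open>A\<close> exactly if the independent uniform variable
  \<open>\<eta> k\<close> lies in \<open>h <# A\<close>, and the uniform law on \<open>H\<close> gives the same mass to \<open>A\<close> and \<open>h <# A\<close>.
  Summing over \<open>h\<close> yields the product formula.\<close>

lemma iid_solution: "iid \<in> solutions G \<mu>"
  unfolding solutions_iff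
proof (intro conjI allI impI)
  interpret prob_space iid by (rule prob_space_iid)
  show "prob_space iid" by (rule prob_space_iid)
  show "sets iid = sets (paths G)" by (rule sets_iid)
  fix k :: int and A B
  assume k: "k \<le> 0" and A: "A \<subseteq> carrier G" and B: "B \<in> sets (past_eta G (k - 1))"
  let ?E = "\<lambda>j A. {\<eta> \<in> space (paths G). \<eta> j \<in> A}"
  let ?A = "{\<eta> \<in> space (paths G). noise G k \<eta> \<in> A}"
  have B': "B \<in> sets (paths G)" "B \<subseteq> space (paths G)"
    using B past_eta_subset[of "k - 1" G] k sets.sets_into_space by auto
  have past: "?E (k - 1) C \<in> sets (past_eta G (k - 1))" for C
    using k by (intro coordinate_event_past) auto
  have C: "?E k (h <# A) \<inter> (B \<inter> ?E (k - 1) {h}) \<in> sets (paths G)"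
      "B \<inter> ?E (k - 1) {h} \<in> sets (paths G)" for h
    using k B' by (intro sets.Int coordinate_event; simp)+
  have split: "?A \<inter> B \<inter> ?E (k - 1) H = (\<Union>h\<in>H. ?E k (h <# A) \<inter> (B \<inter> ?E (k - 1) {h}))"
  proof -
    have "noise G k \<eta> \<in> A \<longleftrightarrow> \<eta> k \<in> \<eta> (k - 1) <# A" if \<eta>: "\<eta> \<in> space (paths G)" for \<eta>
    proof -
      have car: "\<eta> k \<in> carrier G" "\<eta> (k - 1) \<in> carrier G"
        using k \<eta> by (auto intro: coordinate_in_carrier)
      then have "\<eta> k = \<eta> (k - 1) \<otimes> noise G k \<eta>"
        by (simp add: noise_def m_assoc[symmetric])
      moreover have "noise G k \<eta> = a" if "\<eta> k = \<eta> (k - 1) \<otimes> a" "a \<in> A" for a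
        using that car A by (auto simp: noise_def m_assoc[symmetric])
      ultimately show ?thesis unfolding l_coset_def by blast
    qed
    then show ?thesis using B'(2) by auto
  qed
  have "prob (?A \<inter> B) = prob (?A \<inter> B \<inter> ?E (k - 1) H)"
    using B' noise_event[OF k A] k by (intro iid_concentrated sets.Int) auto
  also have "\<dots> = (\<Sum>h\<in>H. prob (?E k (h <# A) \<inter> (B \<inter> ?E (k - 1) {h})))"
    unfolding split using C finite_H
    by (intro finite_measure_finite_Union) (auto simp: disjoint_family_on_def sets_iid)
  also have "\<dots> = (\<Sum>h\<in>H. weight A * prob (B \<inter> ?E (k - 1) {h}))"
  proof (intro sum.cong refl)
    fix h assume h: "h \<in> H"
    have "prob (?E k (h <# A) \<inter> (B \<inter> ?E (k - 1) {h})) = weight (h <# A) * prob (B \<inter> ?E (k - 1) {h})"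
      using k B past h A by (intro indep_past_iid sets.Int past l_coset_subset_G) auto
    then show "prob (?E k (h <# A) \<inter> (B \<inter> ?E (k - 1) {h})) = weight A * prob (B \<inter> ?E (k - 1) {h})"
      using weight_translate[OF h A] by simp
  qed
  also have "\<dots> = weight A * prob (\<Union>h\<in>H. B \<inter> ?E (k - 1) {h})"
    unfolding sum_distrib_left[symmetric] using C finite_H
    by (subst finite_measure_finite_Union) (auto simp: disjoint_family_on_def sets_iid)
  also have "(\<Union>h\<in>H. B \<inter> ?E (k - 1) {h}) = B \<inter> ?E (k - 1) H" by auto
  also have "prob \<dots> = prob B"
    using B' k by (intro iid_concentrated[symmetric]) auto
  finally show "prob (?A \<inter> B) = weight A * prob B" .
qed

end

section \<open>Translates and extremal solutions\<close>

definition shift :: "('a, 'b) monoid_scheme \<Rightarrow> 'a \<Rightarrow> (int \<Rightarrow> 'a) \<Rightarrow> int \<Rightarrow> 'a" where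
  "shift G g \<eta> = (\<lambda>k\<in>{..0::int}. g \<otimes>\<^bsub>G\<^esub> \<eta> k)"

lemma shift_apply [simp]: "k \<le> 0 \<Longrightarrow> shift G g \<eta> k = g \<otimes>\<^bsub>G\<^esub> \<eta> k"
  by (simp add: shift_def)

lemma translate_eq: "translate G g P = distr P (paths G) (shift G g)"
  by (simp add: translate_def shift_def[abs_def])

context subgroup_noise
begin

lemma shift_in_space: "g \<in> carrier G \<Longrightarrow> \<eta> \<in> space (paths G) \<Longrightarrow> shift G g \<eta> \<in> space (paths G)"
  by (auto simp: space_paths shift_def)

text \<open>The factor \<open>g\<close> cancels in \<open>inv (g \<otimes> \<eta> (k - 1)) \<otimes> (g \<otimes> \<eta> k)\<close>.  So the noise sees nothing of a
  left translation; both the translates of solutions and the failure of the noise to determine the path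
  come from this.\<close>

lemma noise_shift:
  assumes "g \<in> carrier G" "\<eta> \<in> space (paths G)" "k \<le> 0"
  shows "noise G k (shift G g \<eta>) = noise G k \<eta>"
proof -
  have "\<eta> k \<in> carrier G" "\<eta> (k - 1) \<in> carrier G"
    using assms by (auto intro: coordinate_in_carrier)
  then have "inv (g \<otimes> \<eta> (k - 1)) \<otimes> (g \<otimes> \<eta> k) = inv (\<eta> (k - 1)) \<otimes> ((inv g \<otimes> g) \<otimes> \<eta> k)"
    using assms by (simp only: inv_mult_group m_assoc m_closed inv_closed)
  then show ?thesis using assms \<open>\<eta> k \<in> carrier G\<close> by (simp add: noise_def)
qed

lemma shift_coordinate_event:
  assumes g: "g \<in> carrier G" and A: "A \<subseteq> carrier G" and j: "j \<le> 0"
  shows "{\<eta> \<in> space (paths G). shift G g \<eta> j \<in> A} = {\<eta> \<in> space (paths G). \<eta> j \<in> inv g <# A}"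
proof -
  have "g \<otimes> y \<in> A \<longleftrightarrow> y \<in> inv g <# A" if y: "y \<in> carrier G" for y
  proof
    assume "g \<otimes> y \<in> A"
    moreover have "y = inv g \<otimes> (g \<otimes> y)" using g y by (simp add: m_assoc[symmetric])
    ultimately show "y \<in> inv g <# A" unfolding l_coset_def by blast
  next
    assume "y \<in> inv g <# A"
    then obtain a where "a \<in> A" "y = inv g \<otimes> a" by (auto simp: l_coset_def)
    then show "g \<otimes> y \<in> A" using g A by (auto simp: m_assoc[symmetric])
  qed
  then show ?thesis using j coordinate_in_carrier[of _ G j] by auto
qed

lemma shift_past_measurable:
  assumes g: "g \<in> carrier G" and k: "k \<le> 0"
  shows "shift G g \<in> past_eta G k \<rightarrow>\<^sub>M past_eta G k"
proof (rule measurable_sigma_sets[OF sets_past_eta])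
  show "shift G g \<in> space (past_eta G k) \<rightarrow> space (paths G)"
    using shift_in_space[OF g] by auto
  fix B assume "B \<in> {(\<lambda>\<eta>. \<eta> j) -` A \<inter> space (paths G) | j A. j \<le> k \<and> A \<subseteq> carrier G}"
  then obtain j A where jA: "j \<le> k" "A \<subseteq> carrier G" and B: "B = (\<lambda>\<eta>. \<eta> j) -` A \<inter> space (paths G)"
    by blast
  have "shift G g -` B \<inter> space (past_eta G k) = {\<eta> \<in> space (paths G). shift G g \<eta> j \<in> A}"
    unfolding B space_past_eta vimage_def using shift_in_space[OF g] by blast
  also have "\<dots> \<in> sets (past_eta G k)"
    unfolding shift_coordinate_event[OF g jA(2) order_trans[OF jA(1) k]]
    using jA(1) k by (rule coordinate_event_past)
  finally show "shift G g -` B \<inter> space (past_eta G k) \<in> sets (past_eta G k)" .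
qed auto

text \<open>The full path space is the past at time \<open>0\<close>, so that the measurability of translations
  follows from that on the pasts.\<close>

lemma sets_paths: "sets (paths G) = sets (past_eta G 0)"
proof
  have "(\<lambda>\<eta>. \<eta> j) \<in> past_eta G 0 \<rightarrow>\<^sub>M count_space (carrier G)" if "j \<le> 0" for j
    using coordinate_event_past[of j 0 G] that
    by (auto simp: measurable_def vimage_def Int_def conj_commute coordinate_in_carrier)
  then have "(\<lambda>\<eta>. \<lambda>j\<in>{..0}. \<eta> j) \<in> past_eta G 0 \<rightarrow>\<^sub>M paths G"
    unfolding paths_def by (intro measurable_restrict) auto
  moreover have "(\<lambda>j\<in>{..0}. \<eta> j) = \<eta>" if "\<eta> \<in> space (paths G)" for \<eta>
    using that by (auto simp: space_paths PiE_def extensional_restrict)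
  ultimately have id: "(\<lambda>\<eta>. \<eta>) \<in> past_eta G 0 \<rightarrow>\<^sub>M paths G"
    by (subst measurable_cong[of _ _ "\<lambda>\<eta>. \<lambda>j\<in>{..0}. \<eta> j"]) auto
  show "sets (paths G) \<subseteq> sets (past_eta G 0)"
  proof
    fix B assume B: "B \<in> sets (paths G)"
    from measurable_sets[OF id B] show "B \<in> sets (past_eta G 0)"
      using sets.sets_into_space[OF B] by (simp add: Int_absorb2)
  qed
qed (simp add: past_eta_subset)

lemma shift_measurable: "g \<in> carrier G \<Longrightarrow> shift G g \<in> paths G \<rightarrow>\<^sub>M paths G"
  using shift_past_measurable[of g 0] measurable_cong_sets[OF sets_paths sets_paths] by auto

lemma measure_translate:
  assumes P: "sets P = sets (paths G)" and g: "g \<in> carrier G" and A: "A \<in> sets (paths G)"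
  shows "measure (translate G g P) A = measure P {\<eta> \<in> space (paths G). shift G g \<eta> \<in> A}"
proof -
  have "shift G g \<in> P \<rightarrow>\<^sub>M paths G"
    using shift_measurable[OF g] measurable_cong_sets[OF P refl] by auto
  then show ?thesis
    unfolding translate_eq using A sets_eq_imp_space_eq[OF P]
    by (subst measure_distr) (auto intro!: arg_cong[where f="measure P"])
qed

lemma translate_solution:
  assumes P: "P \<in> solutions G \<mu>" and g: "g \<in> carrier G"
  shows "translate G g P \<in> solutions G \<mu>"
  unfolding solutions_iff
proof (intro conjI allI impI)
  note P_D = solutionD[OF P]
  have shift: "shift G g \<in> P \<rightarrow>\<^sub>M paths G"
    using shift_measurable[OF g] measurable_cong_sets[OF P_D(2) refl] by auto
  show "prob_space (translate G g P)"
    unfolding translate_eq using P_D(1) shift by (rule prob_space.prob_space_distr)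
  show "sets (translate G g P) = sets (paths G)"
    by (simp add: translate_eq)
  fix k :: int and A B
  assume k: "k \<le> 0" and A: "A \<subseteq> carrier G" and B: "B \<in> sets (past_eta G (k - 1))"
  let ?A = "{\<eta> \<in> space (paths G). noise G k \<eta> \<in> A}"
  let ?B = "{\<eta> \<in> space (paths G). shift G g \<eta> \<in> B}"
  have B': "B \<in> sets (paths G)" using B past_eta_subset[of "k - 1" G] k by auto
  have "?B = shift G g -` B \<inter> space (past_eta G (k - 1))" by auto
  also have "\<dots> \<in> sets (past_eta G (k - 1))"
    using B k by (intro measurable_sets[OF shift_past_measurable[OF g]]) auto
  finally have B_past: "?B \<in> sets (past_eta G (k - 1))" .
  have "{\<eta> \<in> space (paths G). shift G g \<eta> \<in> ?A \<inter> B} = ?A \<inter> ?B"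
    using noise_shift[OF g _ k] shift_in_space[OF g] by auto
  then show "measure (translate G g P) (?A \<inter> B) = weight A * measure (translate G g P) B"
    using measure_translate[OF P_D(2) g] noise_event[OF k A] B' P_D(4)[OF k A B_past]
    by (simp add: sets.Int)
qed

lemma measure_translate_initial:
  assumes P: "P \<in> solutions G \<mu>" and g: "g \<in> carrier G" and A: "A \<subseteq> carrier G"
  shows "measure (translate G g P) {\<eta> \<in> space (paths G). \<eta> 0 \<in> A} =
    measure P {\<eta> \<in> space (paths G). \<eta> 0 \<in> inv g <# A}"
proof -
  have "{\<eta> \<in> space (paths G). shift G g \<eta> \<in> {\<eta> \<in> space (paths G). \<eta> 0 \<in> A}} =
      {\<eta> \<in> space (paths G). shift G g \<eta> 0 \<in> A}"
    using shift_in_space[OF g] by auto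
  then show ?thesis
    using measure_translate[OF solutionD(2)[OF P] g coordinate_event[of 0 G A]]
      shift_coordinate_event[OF g A, of 0] by simp
qed

lemma translate_translate:
  assumes P: "P \<in> solutions G \<mu>" and g: "g \<in> carrier G" and h: "h \<in> carrier G"
  shows "translate G g (translate G h P) = translate G (g \<otimes> h) P"
proof -
  note P_D = solutionD[OF P]
  have shift: "shift G h \<in> P \<rightarrow>\<^sub>M paths G"
    using shift_measurable[OF h] measurable_cong_sets[OF P_D(2) refl] by auto
  have "translate G g (translate G h P) = distr P (paths G) (shift G g \<circ> shift G h)"
    unfolding translate_eq using shift_measurable[OF g] shift by (rule distr_distr)
  also have "\<dots> = translate G (g \<otimes> h) P"
    unfolding translate_eq
    by (intro distr_cong refl) (auto simp: P_D coordinate_in_carrier m_assoc g h shift_def fun_eq_iff)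
  finally show ?thesis .
qed

text \<open>Left cosets are equal or disjoint, so a solution that sits on \<open>g <# H\<close> gives probability one to this
  coset and zero to the others, and \<open>solution_eqI\<close> applies.\<close>

lemma concentrated_unique:
  assumes P: "P \<in> solutions G \<mu>" and Q: "Q \<in> solutions G \<mu>" and g: "g \<in> carrier G"
    and P1: "measure P {\<eta> \<in> space (paths G). \<eta> 0 \<in> g <# H} = 1"
    and Q1: "measure Q {\<eta> \<in> space (paths G). \<eta> 0 \<in> g <# H} = 1"
  shows "P = Q"
proof (rule solution_eqI[OF P Q])
  fix y assume y: "y \<in> carrier G"
  show "measure P {\<eta> \<in> space (paths G). \<eta> 0 \<in> y <# H} =
      measure Q {\<eta> \<in> space (paths G). \<eta> 0 \<in> y <# H}"
  proof (cases "y <# H = g <# H")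
    case False
    then have disjoint: "(y <# H) \<inter> (g <# H) = {}"
      using l_repr_independence[OF _ y subgroup_H] l_repr_independence[OF _ g subgroup_H] by blast
    have null: "measure R {\<eta> \<in> space (paths G). \<eta> 0 \<in> y <# H} = 0"
      if R: "R \<in> solutions G \<mu>" and R1: "measure R {\<eta> \<in> space (paths G). \<eta> 0 \<in> g <# H} = 1" for R
    proof -
      interpret prob_space R using solutionD(1)[OF R] .
      have "prob ({\<eta> \<in> space (paths G). \<eta> 0 \<in> y <# H} \<union> {\<eta> \<in> space (paths G). \<eta> 0 \<in> g <# H}) =
          prob {\<eta> \<in> space (paths G). \<eta> 0 \<in> y <# H} + 1"
        using disjoint R1 coordinate_event[of 0 G]
        by (subst finite_measure_Union) (auto simp: solutionD(2)[OF R])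
      moreover have "prob ({\<eta> \<in> space (paths G). \<eta> 0 \<in> y <# H} \<union> {\<eta> \<in> space (paths G). \<eta> 0 \<in> g <# H}) \<le> 1"
        by (rule prob_le_1)
      ultimately show ?thesis using measure_nonneg[of R "{\<eta> \<in> space (paths G). \<eta> 0 \<in> y <# H}"] by linarith
    qed
    show ?thesis using null[OF P P1] null[OF Q Q1] by simp
  qed (simp add: P1 Q1)
qed

lemma coset_inverse:
  "g \<in> carrier G \<Longrightarrow> inv g <# (g <# H) = H"
  using H_subset by (simp add: lcos_m_assoc lcos_mult_one)

lemma translate_iid_concentrated:
  assumes g: "g \<in> carrier G"
  shows "measure (translate G g iid) {\<eta> \<in> space (paths G). \<eta> 0 \<in> g <# H} = 1"
  using measure_translate_initial[OF iid_solution g l_coset_subset_G[OF H_subset g]]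
    prob_coordinate_iid[of 0 H] H_subset card_H_pos
  by (simp add: coset_inverse[OF g] weight_def)

lemma concentrated_eq_translate_iid:
  assumes P: "P \<in> solutions G \<mu>" and g: "g \<in> carrier G"
    and "measure P {\<eta> \<in> space (paths G). \<eta> 0 \<in> g <# H} = 1"
  shows "P = translate G g iid"
  using concentrated_unique[OF P translate_solution[OF iid_solution g] g] assms
    translate_iid_concentrated[OF g] by simp

text \<open>The translate sits on \<open>g <# H\<close> and the original on \<open>H\<close>; the laws agree exactly if these cosets do.\<close>

lemma translate_iid_eq_iff:
  assumes g: "g \<in> carrier G"
  shows "translate G g iid = iid \<longleftrightarrow> g \<in> H"
proof
  assume "g \<in> H"
  then have "g <# H = H" using coset_join3[OF g subgroup_H] by simp
  then show "translate G g iid = iid"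
    using concentrated_eq_translate_iid[OF iid_solution g] prob_coordinate_iid[of 0 H] H_subset card_H_pos
    by (simp add: weight_def)
next
  assume "translate G g iid = iid"
  then have "weight (g <# H) = 1"
    using translate_iid_concentrated[OF g] prob_coordinate_iid[of 0 "g <# H"]
      l_coset_subset_G[OF H_subset g] by simp
  then have "(g <# H) \<inter> H \<noteq> {}" by (auto simp: weight_def)
  then obtain h where h: "h \<in> H" "g \<otimes> h \<in> H" by (auto simp: l_coset_def)
  have "(g \<otimes> h) \<otimes> inv h \<in> H" using h H_closed by blast
  also have "(g \<otimes> h) \<otimes> inv h = g" using g h(1) by (simp add: m_assoc)
  finally show "g \<in> H" .
qed

lemma isotropy_iid: "isotropy G iid = H"
  using translate_iid_eq_iff by (auto simp: isotropy_def)

text \<open>Some coset has positive probability.  If it were less than one, conditioning on the coset and on its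
  complement would split the solution into two others, contrary to extremality.  Conversely, the
  components of any mixture equal to a solution on one coset must sit on the same coset, where the
  solution is unique.\<close>

theorem extremal_solutions_eq: "extremal_solutions G \<mu> = (\<lambda>g. translate G g iid) ` carrier G"
proof (intro subset_antisym subsetI)
  fix P assume ext: "P \<in> extremal_solutions G \<mu>"
  then have P: "P \<in> solutions G \<mu>" by (simp add: extremal_solutions_def)
  note P_D = solutionD[OF P]
  interpret prob_space P by (rule P_D)
  let ?E = "\<lambda>S. {\<eta> \<in> space (paths G). \<eta> 0 \<in> S}"
  have E: "?E S \<in> sets (paths G)" for S by (intro coordinate_event) simp
  have "\<exists>g\<in>carrier G. prob (?E (g <# H)) \<noteq> 0"
  proof (rule ccontr)
    assume "\<not> ?thesis"
    then have null: "prob (?E (g <# H)) = 0" if "g \<in> carrier G" for g using that by blast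
    have "?E (carrier G) \<subseteq> (\<Union>g\<in>carrier G. ?E (g <# H))"
      using one_in_H by (auto simp: l_coset_def intro!: bexI[of _ "\<one>"])
    moreover have "space (paths G) = ?E (carrier G)"
      using coordinate_in_carrier[of _ G 0] by auto
    ultimately have "prob (space P) \<le> prob (\<Union>g\<in>carrier G. ?E (g <# H))"
      using E by (intro finite_measure_mono) (auto simp: P_D finite_carrier intro!: sets.finite_UN)
    also have "\<dots> \<le> (\<Sum>g\<in>carrier G. prob (?E (g <# H)))"
      using E by (intro finite_measure_subadditive_finite finite_carrier) (auto simp: P_D)
    finally show False using null prob_space by simp
  qed
  then obtain g where g: "g \<in> carrier G" and pos: "prob (?E (g <# H)) > 0"
    by (auto simp: zero_less_measure_iff)
  \<comment> \<open>both sets are unions of left cosets, so conditioning on either gives a solution\<close>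
  let ?S = "g <# H" and ?T = "carrier G - (g <# H)"
  have inv: "right_invariant ?S" using right_invariant_coset[OF g] .
  have invT: "right_invariant ?T"
    unfolding right_invariant_def
  proof (intro conjI ballI)
    fix s h assume s: "s \<in> ?T" and h: "h \<in> H"
    have "s \<in> ?S" if "s \<otimes> h \<in> ?S"
    proof -
      have "s \<otimes> h \<otimes> inv h \<in> ?S" using inv that H_closed(2)[OF h] unfolding right_invariant_def by blast
      then show ?thesis using s h by (simp add: m_assoc)
    qed
    then show "s \<otimes> h \<in> ?T" using s h by auto
  qed auto
  have "space (paths G) - ?E ?S = ?E ?T"
    using coordinate_in_carrier[of _ G 0] by auto
  then have T: "prob (?E ?T) = 1 - prob (?E ?S)"
    using prob_compl[of "?E ?S"] E by (simp add: P_D)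
  have "prob (?E ?S) = 1"
  proof (rule ccontr)
    assume "prob (?E ?S) \<noteq> 1"
    then have posT: "prob (?E ?T) > 0" using T prob_le_1[of "?E ?S"] by linarith
    let ?Q = "uniform_measure P (?E ?S)" and ?R = "uniform_measure P (?E ?T)"
    have split: "prob A = (1 - prob (?E ?T)) * measure ?Q A + prob (?E ?T) * measure ?R A"
      if A: "A \<in> sets (paths G)" for A
    proof -
      have "A = (A \<inter> ?E ?S) \<union> (A \<inter> ?E ?T)"
        using coordinate_in_carrier[of _ G 0] sets.sets_into_space[OF A] by auto
      then have "prob A = prob ((A \<inter> ?E ?S) \<union> (A \<inter> ?E ?T))" by (rule arg_cong)
      also have "\<dots> = prob (A \<inter> ?E ?S) + prob (A \<inter> ?E ?T)"
        using A E by (intro finite_measure_Union) (auto simp: P_D)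
      finally show ?thesis
        using measure_conditioned[OF P E pos A] measure_conditioned[OF P E posT A] pos posT T by simp
    qed
    have "?Q = P"
    proof -
      have "\<forall>Q\<in>solutions G \<mu>. \<forall>R\<in>solutions G \<mu>. \<forall>t::real. 0 < t \<and> t < 1 \<and>
          (\<forall>A\<in>sets (paths G). prob A = (1 - t) * measure Q A + t * measure R A) \<longrightarrow> Q = P \<and> R = P"
        using ext by (simp add: extremal_solutions_def)
      from this[rule_format, OF conditioned_solution[OF P inv pos] conditioned_solution[OF P invT posT],
          of "prob (?E ?T)"]
      show ?thesis using split posT pos T by simp
    qed
    then have "prob (?E ?S) = measure ?Q (?E ?S)" by simp
    also have "\<dots> = 1" using measure_conditioned[OF P E pos E, of ?S] pos by simp
    finally show False using \<open>prob (?E ?S) \<noteq> 1\<close> by simp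
  qed
  then show "P \<in> (\<lambda>g. translate G g iid) ` carrier G"
    using concentrated_eq_translate_iid[OF P g] g by blast
next
  fix P assume "P \<in> (\<lambda>g. translate G g iid) ` carrier G"
  then obtain g where g: "g \<in> carrier G" and P_eq: "P = translate G g iid" by blast
  have P: "P \<in> solutions G \<mu>" using translate_solution[OF iid_solution g] P_eq by simp
  let ?E = "{\<eta> \<in> space (paths G). \<eta> 0 \<in> g <# H}"
  have "Q = P \<and> R = P"
    if Q: "Q \<in> solutions G \<mu>" and R: "R \<in> solutions G \<mu>" and t: "0 < t" "t < 1"
      and mix: "\<forall>A\<in>sets (paths G). measure P A = (1 - t) * measure Q A + t * measure R A" for Q R t
  proof -
    have le: "measure Q ?E \<le> 1" "measure R ?E \<le> 1"
      using solutionD(1)[OF Q] solutionD(1)[OF R] by (auto intro: prob_space.prob_le_1)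
    have "1 = (1 - t) * measure Q ?E + t * measure R ?E"
      using mix coordinate_event[of 0 G] translate_iid_concentrated[OF g] P_eq by auto
    then have "(1 - t) * (1 - measure Q ?E) + t * (1 - measure R ?E) = 0" by (simp add: algebra_simps)
    moreover have "(1 - t) * (1 - measure Q ?E) \<ge> 0" "t * (1 - measure R ?E) \<ge> 0"
      using le t by auto
    ultimately have "(1 - t) * (1 - measure Q ?E) = 0" "t * (1 - measure R ?E) = 0" by linarith+
    then have "measure Q ?E = 1" "measure R ?E = 1" using t by auto
    then show ?thesis
      using concentrated_eq_translate_iid[OF Q g] concentrated_eq_translate_iid[OF R g] P_eq by simp
  qed
  then show "P \<in> extremal_solutions G \<mu>"
    using P unfolding extremal_solutions_def by blast
qed

end

section \<open>Unitary representations and the noise\<close>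

context group
begin

lemma unitary_rep_carrier: "unitary_rep G n \<rho> \<Longrightarrow> g \<in> carrier G \<Longrightarrow> \<rho> g \<in> carrier_mat n n"
  unfolding unitary_rep_def hom_def by (auto simp: ring_mat_simps)

lemma unitary_rep_mult:
  "unitary_rep G n \<rho> \<Longrightarrow> g \<in> carrier G \<Longrightarrow> h \<in> carrier G \<Longrightarrow> \<rho> (g \<otimes> h) = \<rho> g * \<rho> h"
  unfolding unitary_rep_def hom_def by (auto simp: ring_mat_simps)

text \<open>A homomorphism into the multiplicative monoid of all matrices could send the unit to any idempotent;
  unitarity makes this idempotent invertible.\<close>

lemma unitary_rep_one:
  assumes \<rho>: "unitary_rep G n \<rho>" shows "\<rho> \<one> = 1\<^sub>m n"
proof -
  have car: "\<rho> \<one> \<in> carrier_mat n n" using unitary_rep_carrier[OF \<rho>] by simp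
  then have adj: "mat_adjoint (\<rho> \<one>) \<in> carrier_mat n n"
    unfolding mat_adjoint_def by (auto simp: mat_of_rows_def)
  have unit: "mat_adjoint (\<rho> \<one>) * \<rho> \<one> = 1\<^sub>m n"
    using \<rho> by (simp add: unitary_rep_def)
  have "mat_adjoint (\<rho> \<one>) * \<rho> \<one> * \<rho> \<one> = mat_adjoint (\<rho> \<one>) * (\<rho> \<one> * \<rho> \<one>)"
    using car adj by (intro assoc_mult_mat)
  also have "\<rho> \<one> * \<rho> \<one> = \<rho> \<one>" using unitary_rep_mult[OF \<rho>, of \<one> \<one>] by simp
  finally show ?thesis using car by (simp add: unit)
qed

lemma unitary_rep_kernel_conj:
  assumes \<rho>: "unitary_rep G n \<rho>" and g: "g \<in> carrier G" and h: "h \<in> carrier G" and one: "\<rho> h = 1\<^sub>m n"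
  shows "\<rho> (g \<otimes> h \<otimes> inv g) = 1\<^sub>m n"
proof -
  have "\<rho> (g \<otimes> h \<otimes> inv g) = \<rho> g * 1\<^sub>m n * \<rho> (inv g)"
    using g h by (simp add: unitary_rep_mult[OF \<rho>] one)
  also have "\<dots> = \<rho> (g \<otimes> inv g)"
    using g unitary_rep_carrier[OF \<rho>, of g] unitary_rep_mult[OF \<rho> g inv_closed[OF g]] by (simp del: r_inv)
  finally show ?thesis using g by (simp add: unitary_rep_one[OF \<rho>])
qed

lemma unitary_rep_cancel:
  assumes \<rho>: "unitary_rep G n \<rho>" and c: "c \<in> carrier G" and a: "a \<in> carrier G"
    and eq: "\<rho> (c \<otimes> a) = \<rho> a"
  shows "\<rho> c = 1\<^sub>m n"
proof -
  have "\<rho> c = \<rho> (c \<otimes> a \<otimes> inv a)" using c a by (simp add: m_assoc)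
  also have "\<dots> = \<rho> (c \<otimes> a) * \<rho> (inv a)" using c a by (intro unitary_rep_mult[OF \<rho>]) auto
  also have "\<dots> = \<rho> (a \<otimes> inv a)" using a by (simp only: eq unitary_rep_mult[OF \<rho>] inv_closed)
  finally show ?thesis using a by (simp add: unitary_rep_one[OF \<rho>])
qed

end

lemma uniform_measure_eq_point_measure:
  assumes "finite A" "B \<subseteq> A" "B \<noteq> {}"
  shows "uniform_measure (count_space A) B = point_measure A (\<lambda>x. if x \<in> B then 1 / real (card B) else 0)"
proof -
  have B: "finite B" "card B > 0" using assms finite_subset by (auto simp: card_gt_0_iff)
  then have "1 / ennreal (real (card B)) = ennreal (1 / real (card B))"
    by (metis divide_ennreal ennreal_1 of_nat_0_less_iff zero_le_one)
  then show ?thesis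
    unfolding uniform_measure_def point_measure_def using assms(2) B
    by (auto simp: emeasure_count_space_finite ennreal_of_nat_eq_real_of_nat intro!: density_cong)
qed

context subgroup_noise
begin

lemma rep_mean_eq:
  assumes k: "k \<le> 0"
  shows "rep_mean \<mu> n \<rho> k = mat n n (\<lambda>(i, j). (\<Sum>h\<in>H. \<rho> h $$ (i, j)) / of_nat (card H))"
proof -
  have "(\<integral>g. f g \<partial>\<mu> k) = (\<Sum>h\<in>H. f h) / of_nat (card H)" for f :: "'a \<Rightarrow> complex"
  proof -
    have "(\<integral>g. f g \<partial>\<mu> k) = (\<Sum>g\<in>carrier G. (if g \<in> H then 1 / real (card H) else 0) *\<^sub>R f g)"
      unfolding noise_law[OF k] using finite_carrier H_subset one_in_H
      by (subst uniform_measure_eq_point_measure) (auto simp: lebesgue_integral_point_measure_finite)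
    also have "\<dots> = (\<Sum>g\<in>H. (1 / real (card H)) *\<^sub>R f g)"
      using finite_carrier H_subset by (intro sum.mono_neutral_cong_right) auto
    finally show ?thesis by (simp add: scaleR_conv_of_real sum_divide_distrib)
  qed
  then show ?thesis unfolding rep_mean_def by simp
qed

lemma rep_mean_carrier: "rep_mean \<mu> n \<rho> k \<in> carrier_mat n n"
  by (simp add: rep_mean_def)

text \<open>Left multiplication by \<open>h\<close> permutes the subgroup over which the average is taken.  Consequently every
  column of the mean is a fixed vector of \<open>H\<close>, and the mean is a projection.\<close>

lemma rep_mult_mean:
  assumes \<rho>: "unitary_rep G n \<rho>" and h: "h \<in> H" and k: "k \<le> 0"
  shows "\<rho> h * rep_mean \<mu> n \<rho> k = rep_mean \<mu> n \<rho> k"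
proof (rule eq_matI)
  let ?R = "rep_mean \<mu> n \<rho> k"
  have car: "\<rho> g \<in> carrier_mat n n" if "g \<in> H" for g
    using unitary_rep_carrier[OF \<rho>] that by simp
  have R: "?R \<in> carrier_mat n n" by (rule rep_mean_carrier)
  fix i j assume "i < dim_row ?R" "j < dim_col ?R"
  then have ij: "i < n" "j < n" using R by auto
  have "(\<rho> h * ?R) $$ (i, j) = (\<Sum>l<n. \<rho> h $$ (i, l) * ?R $$ (l, j))"
    using ij car[OF h] R by (auto simp: scalar_prod_def atLeast0LessThan intro!: sum.cong)
  also have "\<dots> = (\<Sum>l<n. \<Sum>g\<in>H. \<rho> h $$ (i, l) * \<rho> g $$ (l, j) / of_nat (card H))"
    using ij by (intro sum.cong) (auto simp: rep_mean_eq[OF k] sum_distrib_left sum_divide_distrib)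
  also have "\<dots> = (\<Sum>g\<in>H. (\<Sum>l<n. \<rho> h $$ (i, l) * \<rho> g $$ (l, j)) / of_nat (card H))"
    by (subst sum.swap) (simp add: sum_divide_distrib)
  also have "\<dots> = (\<Sum>g\<in>H. \<rho> (h \<otimes> g) $$ (i, j) / of_nat (card H))"
  proof (intro sum.cong refl)
    fix g assume g: "g \<in> H"
    have "\<rho> (h \<otimes> g) $$ (i, j) = (\<rho> h * \<rho> g) $$ (i, j)"
      using unitary_rep_mult[OF \<rho>] h g by simp
    also have "\<dots> = (\<Sum>l<n. \<rho> h $$ (i, l) * \<rho> g $$ (l, j))"
      using ij car[OF h] car[OF g] by (auto simp: scalar_prod_def atLeast0LessThan intro!: sum.cong)
    finally show "(\<Sum>l<n. \<rho> h $$ (i, l) * \<rho> g $$ (l, j)) / of_nat (card H) =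
        \<rho> (h \<otimes> g) $$ (i, j) / of_nat (card H)" by simp
  qed
  also have "\<dots> = (\<Sum>g\<in>H. \<rho> g $$ (i, j) / of_nat (card H))"
    using h H_closed
    by (intro sum.reindex_bij_witness[of _ "\<lambda>g. inv h \<otimes> g" "\<lambda>g. h \<otimes> g"]) (auto simp: m_assoc[symmetric])
  also have "\<dots> = ?R $$ (i, j)"
    using ij by (simp add: rep_mean_eq[OF k] sum_divide_distrib)
  finally show "(\<rho> h * ?R) $$ (i, j) = ?R $$ (i, j)" .
qed (use rep_mean_carrier[of n \<rho> k] unitary_rep_carrier[OF \<rho> in_carrier[OF h]] in auto)

lemma rep_mean_idempotent:
  assumes \<rho>: "unitary_rep G n \<rho>" and k: "k \<le> 0"
  shows "rep_mean \<mu> n \<rho> k * rep_mean \<mu> n \<rho> k = rep_mean \<mu> n \<rho> k"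
proof (rule eq_matI)
  let ?R = "rep_mean \<mu> n \<rho> k"
  have R: "?R \<in> carrier_mat n n" by (rule rep_mean_carrier)
  fix i j assume "i < dim_row ?R" "j < dim_col ?R"
  then have ij: "i < n" "j < n" using R by auto
  have "(?R * ?R) $$ (i, j) = (\<Sum>l<n. ?R $$ (i, l) * ?R $$ (l, j))"
    using ij R by (auto simp: scalar_prod_def atLeast0LessThan intro!: sum.cong)
  also have "\<dots> = (\<Sum>l<n. \<Sum>h\<in>H. \<rho> h $$ (i, l) * ?R $$ (l, j) / of_nat (card H))"
  proof (intro sum.cong refl)
    fix l assume "l \<in> {..<n}"
    then have "?R $$ (i, l) = (\<Sum>h\<in>H. \<rho> h $$ (i, l)) / of_nat (card H)"
      using ij by (simp add: rep_mean_eq[OF k])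
    then show "?R $$ (i, l) * ?R $$ (l, j) = (\<Sum>h\<in>H. \<rho> h $$ (i, l) * ?R $$ (l, j) / of_nat (card H))"
      by (simp add: sum_distrib_right sum_divide_distrib)
  qed
  also have "\<dots> = (\<Sum>h\<in>H. (\<Sum>l<n. \<rho> h $$ (i, l) * ?R $$ (l, j)) / of_nat (card H))"
    by (subst sum.swap) (simp add: sum_divide_distrib)
  also have "\<dots> = (\<Sum>h\<in>H. ?R $$ (i, j) / of_nat (card H))"
  proof (intro sum.cong refl)
    fix h assume h: "h \<in> H"
    have "?R $$ (i, j) = (\<rho> h * ?R) $$ (i, j)" using rep_mult_mean[OF \<rho> h k] by simp
    also have "\<dots> = (\<Sum>l<n. \<rho> h $$ (i, l) * ?R $$ (l, j))"
      using ij R unitary_rep_carrier[OF \<rho> in_carrier[OF h]]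
      by (auto simp: scalar_prod_def atLeast0LessThan intro!: sum.cong)
    finally show "(\<Sum>l<n. \<rho> h $$ (i, l) * ?R $$ (l, j)) / of_nat (card H) = ?R $$ (i, j) / of_nat (card H)"
      by simp
  qed
  also have "\<dots> = ?R $$ (i, j)" using card_H_pos by simp
  finally show "(?R * ?R) $$ (i, j) = ?R $$ (i, j)" .
qed (use rep_mean_carrier[of n \<rho> k] in auto)

lemma rep_mean_prod_eq:
  assumes \<rho>: "unitary_rep G n \<rho>" and k: "k \<le> 0"
  shows "rep_mean_prod \<mu> n \<rho> k m = rep_mean \<mu> n \<rho> k"
proof (induction m)
  case (Suc m)
  have "rep_mean \<mu> n \<rho> (k - int (Suc m)) = rep_mean \<mu> n \<rho> k"
    using k by (simp add: rep_mean_eq)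
  then show ?case using Suc rep_mean_idempotent[OF \<rho> k] by simp
qed simp

lemma r1_eq: "unitary_rep G n \<rho> \<Longrightarrow> k \<le> 0 \<Longrightarrow> r1 \<mu> n \<rho> k = op_norm (rep_mean \<mu> n \<rho> k)"
  and r2_eq: "unitary_rep G n \<rho> \<Longrightarrow> k \<le> 0 \<Longrightarrow> r2 \<mu> n \<rho> k = cmod (Determinant.det (rep_mean \<mu> n \<rho> k))"
  by (simp_all add: r1_def r2_def rep_mean_prod_eq)

text \<open>An invertible projection is the identity, and then \<open>\<rho> h * R = R\<close> reads \<open>\<rho> h = 1\<close>.\<close>

lemma reps2_trivial_on_H:
  assumes reps: "(n, \<rho>) \<in> reps2 G \<mu>" and h: "h \<in> H"
  shows "\<rho> h = 1\<^sub>m n"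
proof -
  from reps obtain k where \<rho>: "unitary_rep G n \<rho>" and k: "k \<le> 0" and "r2 \<mu> n \<rho> k > 0"
    by (auto simp: reps2_def unitary_irreps_def)
  then have det: "Determinant.det (rep_mean \<mu> n \<rho> k) \<noteq> 0" by (auto simp: r2_eq)
  let ?R = "rep_mean \<mu> n \<rho> k"
  have R: "?R \<in> carrier_mat n n" by (rule rep_mean_carrier)
  from det_non_zero_imp_unit[OF R det, of "()"] obtain B where B: "B \<in> carrier_mat n n" "B * ?R = 1\<^sub>m n"
    by (auto simp: Units_def ring_mat_simps)
  have "?R = B * ?R * ?R" using R by (simp add: B(2))
  also have "\<dots> = B * (?R * ?R)" using B R by (intro assoc_mult_mat)
  also have "\<dots> = 1\<^sub>m n" by (simp add: rep_mean_idempotent[OF \<rho> k] B(2))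
  finally have "?R = 1\<^sub>m n" .
  then show ?thesis
    using rep_mult_mean[OF \<rho> h k] unitary_rep_carrier[OF \<rho> in_carrier[OF h]] by simp
qed

text \<open>The generating events are invariant under translation by \<open>noise_shift\<close>, and the invariant sets form a
  sigma-algebra.\<close>

lemma past_noise_invariant:
  assumes B: "B \<in> sets (past_noise G k)" and k: "k \<le> 0" and c: "c \<in> carrier G" and \<eta>: "\<eta> \<in> space (paths G)"
  shows "shift G c \<eta> \<in> B \<longleftrightarrow> \<eta> \<in> B"
  using B unfolding sets_past_noise
proof induction
  case (Basic B)
  then obtain j A where "j \<le> k" "B = noise G j -` A \<inter> space (paths G)" by blast
  then show ?case using noise_shift[OF c \<eta>, of j] shift_in_space[OF c \<eta>] \<eta> k by simp
qed (use shift_in_space[OF c \<eta>] \<eta> in auto)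

text \<open>Let \<open>f\<close> be noise-measurable with \<open>\<rho> (\<eta> 0) = f \<eta>\<close> almost surely.  The element \<open>c = g \<otimes> h \<otimes> inv g\<close>
  maps the coset \<open>g <# H\<close> to itself, so the law is invariant under translation by \<open>c\<close> and the identity
  holds at the translated path too.  There \<open>f\<close> has the same value, whence \<open>\<rho> (c \<otimes> \<eta> 0) = \<rho> (\<eta> 0)\<close>
  and \<open>\<rho> c = 1\<close>; finally \<open>h\<close> is a conjugate of \<open>c\<close>.\<close>

lemma reps_s_trivial_on_H:
  assumes reps: "(n, \<rho>) \<in> reps_s G (translate G g iid)" and g: "g \<in> carrier G" and h: "h \<in> H"
  shows "\<rho> h = 1\<^sub>m n"
proof -
  let ?P = "translate G g iid"
  have P: "?P \<in> solutions G \<mu>" using iid_solution g by (rule translate_solution)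
  note P_D = solutionD[OF P]
  interpret prob_space ?P by (rule P_D)
  from reps have \<rho>: "unitary_rep G n \<rho>"
    by (simp add: reps_s_def unitary_irreps_def)
  from reps have "\<forall>k\<le>0. \<exists>f :: (int \<Rightarrow> 'a) \<Rightarrow> complex mat.
       f \<in> space (paths G) \<rightarrow> carrier_mat n n \<and>
       (\<forall>i<n. \<forall>j<n. (\<lambda>\<eta>. f \<eta> $$ (i, j)) \<in> borel_measurable (past_noise G k)) \<and>
       (AE \<eta> in ?P. \<rho> (\<eta> k) = f \<eta>)"
    by (simp add: reps_s_def)
  from this[rule_format, of 0] obtain f :: "(int \<Rightarrow> 'a) \<Rightarrow> complex mat"
    where f_car: "f \<in> space (paths G) \<rightarrow> carrier_mat n n"
      and f_meas: "\<And>i j. i < n \<Longrightarrow> j < n \<Longrightarrow> (\<lambda>\<eta>. f \<eta> $$ (i, j)) \<in> borel_measurable (past_noise G 0)"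
      and f_eq: "AE \<eta> in ?P. \<rho> (\<eta> 0) = f \<eta>"
    by auto
  define c where "c = g \<otimes> h \<otimes> inv g"
  have c: "c \<in> carrier G" using g h by (simp add: c_def)
  have cg: "c \<otimes> g = g \<otimes> h" using g h by (simp add: c_def m_assoc)
  have f_inv: "f (shift G c \<eta>) = f \<eta>" if \<eta>: "\<eta> \<in> space (paths G)" for \<eta>
  proof (rule eq_matI)
    have car: "f \<eta> \<in> carrier_mat n n" "f (shift G c \<eta>) \<in> carrier_mat n n"
      using f_car \<eta> shift_in_space[OF c \<eta>] by auto
    then show "dim_row (f (shift G c \<eta>)) = dim_row (f \<eta>)" "dim_col (f (shift G c \<eta>)) = dim_col (f \<eta>)"
      by auto
    fix i j assume "i < dim_row (f \<eta>)" "j < dim_col (f \<eta>)"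
    then have ij: "i < n" "j < n" using car by auto
    \<comment> \<open>the level set of the entry through \<open>\<eta>\<close> is a noise event, so it contains the translate of \<open>\<eta>\<close>\<close>
    let ?B = "(\<lambda>\<eta>. f \<eta> $$ (i, j)) -` {f \<eta> $$ (i, j)} \<inter> space (past_noise G 0)"
    have "?B \<in> sets (past_noise G 0)"
      using f_meas[OF ij] by (rule measurable_sets) simp
    from past_noise_invariant[OF this _ c \<eta>] have "shift G c \<eta> \<in> ?B" using \<eta> by simp
    then show "f (shift G c \<eta>) $$ (i, j) = f \<eta> $$ (i, j)" by simp
  qed
  have "translate G c ?P = translate G (g \<otimes> h) iid"
    using translate_translate[OF iid_solution c g] by (simp add: cg)
  also have "\<dots> = translate G g (translate G h iid)"
    using translate_translate[OF iid_solution g in_carrier[OF h]] by simp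
  also have "\<dots> = ?P" using translate_iid_eq_iff[OF in_carrier[OF h]] h by simp
  finally have stable: "translate G c ?P = ?P" .
  have shift: "shift G c \<in> ?P \<rightarrow>\<^sub>M paths G"
    using shift_measurable[OF c] measurable_cong_sets[OF P_D(2) refl] by auto
  have "AE \<eta> in distr ?P (paths G) (shift G c). \<rho> (\<eta> 0) = f \<eta>"
    using f_eq unfolding translate_eq[symmetric] stable .
  from AE_distrD[OF shift this] have "AE \<eta> in ?P. \<rho> (shift G c \<eta> 0) = f (shift G c \<eta>)" .
  with f_eq AE_space have "AE \<eta> in ?P. \<rho> c = 1\<^sub>m n"
  proof eventually_elim
    case (elim \<eta>)
    then have \<eta>: "\<eta> \<in> space (paths G)" using P_D(3) by simp
    have "\<rho> (c \<otimes> \<eta> 0) = \<rho> (\<eta> 0)" using elim f_inv[OF \<eta>] by simp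
    then show "\<rho> c = 1\<^sub>m n"
      using unitary_rep_cancel[OF \<rho> c] coordinate_in_carrier[OF \<eta>, of 0] by simp
  qed
  \<comment> \<open>a statement without \<open>\<eta>\<close> that holds almost surely is true\<close>
  then have "\<rho> c = 1\<^sub>m n" by (simp add: AE_const)
  from unitary_rep_kernel_conj[OF \<rho> _ c this, of "inv g"]
  have "\<rho> (inv g \<otimes> c \<otimes> g) = 1\<^sub>m n" using g by simp
  moreover have "inv g \<otimes> c \<otimes> g = h"
    using g h by (simp add: c_def m_assoc) (simp add: m_assoc[symmetric])
  ultimately show ?thesis by simp
qed

end

section \<open>The symmetric group of degree three\<close>

lemma carrier_S3: "carrier S3 = {p. p permutes {1..3}}"
  and mult_S3: "\<sigma> \<otimes>\<^bsub>S3\<^esub> \<tau> = \<tau> \<circ> \<sigma>"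
  and one_S3: "\<one>\<^bsub>S3\<^esub> = id"
  by (simp_all add: S3_def)

lemma group_S3: "group S3"
proof (rule groupI)
  fix p assume p: "p \<in> carrier S3"
  then have "inv_into UNIV p \<in> carrier S3" "inv_into UNIV p \<otimes>\<^bsub>S3\<^esub> p = \<one>\<^bsub>S3\<^esub>"
    by (auto simp: carrier_S3 mult_S3 one_S3 permutes_inv permutes_inv_o)
  then show "\<exists>q\<in>carrier S3. q \<otimes>\<^bsub>S3\<^esub> p = \<one>\<^bsub>S3\<^esub>" by blast
qed (auto simp: carrier_S3 mult_S3 one_S3 permutes_compose permutes_id comp_assoc)

lemma transposition_in_S3: "a \<in> {1..3} \<Longrightarrow> b \<in> {1..3} \<Longrightarrow> Transposition.transpose a b \<in> carrier S3"
  by (simp add: carrier_S3 permutes_swap_id)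

lemma cycle_pair: "cycle_of_list [a, b] = Transposition.transpose a b"
  by simp

lemma Ho_eq: "Ho = {id, Transposition.transpose 1 2}"
  by (simp add: Ho_def)

lemma transpose_12_neq_id: "Transposition.transpose 1 2 \<noteq> (id :: nat \<Rightarrow> nat)"
  by (simp add: fun_eq_iff Transposition.transpose_def exI[of _ 1])

lemma card_Ho: "card Ho = 2"
  using transpose_12_neq_id by (simp add: Ho_eq eq_commute)

lemma subgroup_Ho: "subgroup Ho S3"
proof -
  interpret group S3 by (rule group_S3)
  let ?t = "Transposition.transpose 1 (2::nat)"
  have t: "?t \<in> carrier S3" by (intro transposition_in_S3) auto
  have tt: "?t \<otimes>\<^bsub>S3\<^esub> ?t = \<one>\<^bsub>S3\<^esub>" by (simp add: mult_S3 one_S3)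
  have "inv\<^bsub>S3\<^esub> ?t = ?t" using inv_equality[OF tt t t] .
  moreover have "inv\<^bsub>S3\<^esub> id = id" using inv_one by (simp add: one_S3)
  moreover have "id \<in> carrier S3" using one_closed by (simp add: one_S3)
  ultimately show ?thesis
    using t tt by (intro subgroupI) (auto simp: Ho_eq mult_S3 one_S3)
qed

lemma nuo_eq: "nuo = uniform_measure (count_space (carrier S3)) Ho"
proof -
  have "ennreal (1 / real (card Ho)) = 1 / 2"
    using divide_ennreal[of 1 2] by (simp add: card_Ho)
  then have "ennreal (if g \<in> Ho then 1 / real (card Ho) else 0) =
      (if g = id \<or> g = cycle_of_list [1, 2] then 1 / 2 else 0)" for g
    by (simp add: Ho_def)
  moreover have "finite (carrier S3)" by (simp add: carrier_S3 finite_permutations)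
  moreover have "Ho \<subseteq> carrier S3" using subgroup_Ho by (rule subgroup.subset)
  ultimately show ?thesis
    by (subst uniform_measure_eq_point_measure) (auto simp: nuo_def Ho_def)
qed

lemma subgroup_noise_S3:
  assumes "\<And>k. k \<le> 0 \<Longrightarrow> \<mu> k = nuo" shows "subgroup_noise S3 Ho \<mu>"
  using assms group_S3 subgroup_Ho
  by (auto simp: subgroup_noise_def subgroup_noise_axioms_def nuo_eq carrier_S3 finite_permutations)

lemma stabilizer_of_3:
  assumes "p \<in> carrier S3" "p 3 = 3" shows "p \<in> Ho"
proof -
  have "p permutes {1, 2}"
  proof (rule permutes_superset)
    show "p permutes {1..3}" using assms by (simp add: carrier_S3)
    fix x :: nat assume "x \<in> {1..3} - {1, 2}"
    then have "x = 3" by auto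
    then show "p x = x" using assms by simp
  qed
  then show ?thesis by (simp add: permutes_doubleton_iff Ho_eq)
qed

text \<open>For the left-to-right product the coset of \<open>g\<close> modulo the stabiliser of \<open>3\<close> is determined by
  the point that \<open>g\<close> sends to \<open>3\<close>, and the three representatives send \<open>3\<close>, \<open>1\<close> and \<open>2\<close> there.\<close>

lemma left_cosets_of_Ho:
  assumes g: "g \<in> carrier S3"
  obtains c h where "c \<in> {id, cycle_of_list [1, 3], cycle_of_list [1, 2, 3]}" "h \<in> Ho" "g = c \<otimes>\<^bsub>S3\<^esub> h"
proof -
  let ?C = "{id, cycle_of_list [1, 3], cycle_of_list [1, 2, 3 :: nat]}"
  have C: "c \<in> carrier S3" if "c \<in> ?C" for c
    using that transposition_in_S3 group.is_monoid[OF group_S3, THEN monoid.m_closed]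
    by (auto simp: carrier_S3 intro!: permutes_compose permutes_swap_id permutes_id)
  obtain x where x: "x \<in> {1..3}" "g x = 3"
    using g permutes_image[of g "{1..3}"] by (metis (no_types, lifting) carrier_S3 atLeastAtMost_iff
      imageE mem_Collect_eq numeral_le_iff one_le_numeral order_refl)
  have "\<exists>c\<in>?C. c x = 3"
  proof -
    from x(1) have "x = 1 \<or> x = 2 \<or> x = 3" by auto
    then show ?thesis by (auto simp: Transposition.transpose_def)
  qed
  then obtain c where c: "c \<in> ?C" "c x = 3" by blast
  let ?h = "g \<circ> inv_into UNIV c"
  have c_perm: "c permutes {1..3}" using C[OF c(1)] by (simp add: carrier_S3)
  have "inv_into UNIV c 3 = x" using c(2) permutes_inv_eq[OF c_perm] by blast
  then have "?h \<in> Ho"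
    using g c_perm x by (intro stabilizer_of_3) (auto simp: carrier_S3 permutes_compose permutes_inv)
  moreover have "g = c \<otimes>\<^bsub>S3\<^esub> ?h"
    by (simp add: mult_S3 comp_assoc permutes_inv_o[OF c_perm])
  ultimately show thesis using that c(1) by blast
qed

text \<open>Conjugating by the transposition of \<open>a\<close> and \<open>b\<close> turns the transposition of \<open>b\<close> and \<open>c\<close> into that of
  \<open>a\<close> and \<open>c\<close>.\<close>

lemma unitary_rep_S3_transposition:
  assumes \<rho>: "unitary_rep S3 n \<rho>" and abc: "a \<in> {1..3}" "b \<in> {1..3}" "c \<in> {1..3}" "a \<noteq> c" "b \<noteq> c"
    and one: "\<rho> (Transposition.transpose b c) = 1\<^sub>m n"
  shows "\<rho> (Transposition.transpose a c) = 1\<^sub>m n"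
proof -
  interpret group S3 by (rule group_S3)
  let ?ab = "Transposition.transpose a b" and ?bc = "Transposition.transpose b c"
  have car: "?ab \<in> carrier S3" "?bc \<in> carrier S3"
    using abc by (auto intro!: transposition_in_S3)
  have "inv\<^bsub>S3\<^esub> ?ab = ?ab"
    using car by (intro inv_equality) (auto simp: mult_S3 one_S3)
  then have "?ab \<otimes>\<^bsub>S3\<^esub> ?bc \<otimes>\<^bsub>S3\<^esub> inv\<^bsub>S3\<^esub> ?ab = ?ab \<circ> ?bc \<circ> ?ab"
    by (simp add: mult_S3 comp_assoc)
  also have "\<dots> = Transposition.transpose a c"
    using abc by (intro transpose_comp_triple)
  finally have conj: "?ab \<otimes>\<^bsub>S3\<^esub> ?bc \<otimes>\<^bsub>S3\<^esub> inv\<^bsub>S3\<^esub> ?ab = Transposition.transpose a c" .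
  show ?thesis
    using unitary_rep_kernel_conj[OF \<rho>, OF car, OF one] unfolding conj .
qed

lemma unitary_rep_S3_trivial:
  assumes \<rho>: "unitary_rep S3 n \<rho>" and t: "\<And>h. h \<in> Ho \<Longrightarrow> \<rho> h = 1\<^sub>m n" and g: "g \<in> carrier S3"
  shows "\<rho> g = 1\<^sub>m n"
proof -
  interpret group S3 by (rule group_S3)
  let ?t = "Transposition.transpose :: nat \<Rightarrow> nat \<Rightarrow> nat \<Rightarrow> nat"
  have car: "?t 1 2 \<in> carrier S3" "?t 1 3 \<in> carrier S3" "?t 2 3 \<in> carrier S3"
    by (auto intro!: transposition_in_S3)
  have t12: "\<rho> (?t 1 2) = 1\<^sub>m n" using t by (simp add: Ho_eq)
  have t13: "\<rho> (?t 1 3) = 1\<^sub>m n"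
    using unitary_rep_S3_transposition[OF \<rho>, of 3 2 1] t12 by (simp add: transpose_commute)
  have t23: "\<rho> (?t 2 3) = 1\<^sub>m n"
    using unitary_rep_S3_transposition[OF \<rho>, of 3 1 2] t12 by (simp add: transpose_commute)
  have c123: "cycle_of_list [1, 2, 3] = ?t 2 3 \<otimes>\<^bsub>S3\<^esub> ?t 1 2"
    by (simp add: mult_S3)
  have "\<rho> (cycle_of_list [1, 2, 3]) = 1\<^sub>m n" "cycle_of_list [1, 2, 3] \<in> carrier S3"
    unfolding c123 using car t12 t23 by (auto simp: unitary_rep_mult[OF \<rho>])
  moreover have "\<rho> id = 1\<^sub>m n" "id \<in> carrier S3"
    using unitary_rep_one[OF \<rho>] one_closed by (simp_all add: one_S3)
  ultimately have reps: "c \<in> carrier S3 \<and> \<rho> c = 1\<^sub>m n"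
    if "c \<in> {id, cycle_of_list [1, 3], cycle_of_list [1, 2, 3]}" for c
    using that car(2) t13 unfolding cycle_pair by blast
  from left_cosets_of_Ho[OF g] obtain c h
    where ch: "c \<in> {id, cycle_of_list [1, 3], cycle_of_list [1, 2, 3]}" "h \<in> Ho" "g = c \<otimes>\<^bsub>S3\<^esub> h" .
  have "h \<in> carrier S3" using subgroup.mem_carrier[OF subgroup_Ho ch(2)] .
  then show ?thesis
    using reps[OF ch(1)] t[OF ch(2)] unfolding ch(3) by (simp add: unitary_rep_mult[OF \<rho>])
qed

section \<open>The plane representation by symmetries of a triangle\<close>

text \<open>The two coordinates of the vertices \<open>1, 2, 3\<close> of an equilateral triangle inscribed in the unit circle.
  Vertex \<open>3\<close> lies on the first axis, so that exchanging the vertices \<open>1\<close> and \<open>2\<close> is the reflection in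
  this axis.\<close>

definition vertex :: "nat \<Rightarrow> nat \<Rightarrow> complex" where
  "vertex x a = (if a = 0 then (if x = 3 then 1 else - (1 / 2))
     else (if x = 1 then of_real (sqrt 3 / 2) else if x = 2 then - of_real (sqrt 3 / 2) else 0))"

text \<open>The linear map sending the vertex \<open>p i\<close> to the vertex \<open>i\<close>, written as
  \<open>2 / 3 * (\<Sum>i. v i * (v (p i))\<^sup>T)\<close>.  The direction from \<open>p i\<close> back to \<open>i\<close> makes it multiplicative
  for the left-to-right product.\<close>

definition triangle_rep :: "(nat \<Rightarrow> nat) \<Rightarrow> complex mat" where
  "triangle_rep p = mat 2 2 (\<lambda>(a, b). 2 / 3 * (\<Sum>i\<in>{1..3}. vertex i a * vertex (p i) b))"

lemma sum_1_3: "(\<Sum>i\<in>{1..3::nat}. f i) = f 1 + f 2 + (f 3 :: complex)"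
  by (simp add: numeral_3_eq_3 numeral_2_eq_2)

lemma sqrt3_squared: "complex_of_real (sqrt 3) * complex_of_real (sqrt 3) = 3"
  by (simp flip: of_real_mult)

lemma vertex_gram:
  "x \<in> {1..3} \<Longrightarrow> y \<in> {1..3} \<Longrightarrow> (\<Sum>a<2. vertex x a * vertex y a) = (if x = y then 1 else - (1 / 2))"
proof -
  assume "x \<in> {1..3}" "y \<in> {1..3}"
  then have "x = 1 \<or> x = 2 \<or> x = 3" "y = 1 \<or> y = 2 \<or> y = 3" by auto
  then show ?thesis
    by (elim disjE) (simp_all add: vertex_def numeral_2_eq_2 lessThan_Suc sqrt3_squared)
qed

lemma vertex_sum: "(\<Sum>i\<in>{1..3}. vertex i a) = 0"
  unfolding sum_1_3 by (simp add: vertex_def)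

lemma vertex_frame:
  "a < 2 \<Longrightarrow> b < 2 \<Longrightarrow> 2 / 3 * (\<Sum>i\<in>{1..3}. vertex i a * vertex i b) = (if a = b then 1 else 0)"
  unfolding sum_1_3 by (auto simp: less_2_cases_iff vertex_def sqrt3_squared)

lemma triangle_rep_carrier: "triangle_rep p \<in> carrier_mat 2 2"
  by (simp add: triangle_rep_def)

lemma triangle_rep_entry:
  "a < 2 \<Longrightarrow> b < 2 \<Longrightarrow> triangle_rep p $$ (a, b) = 2 / 3 * (\<Sum>i\<in>{1..3}. vertex i a * vertex (p i) b)"
  by (simp add: triangle_rep_def)

text \<open>The inner product of two vertices is \<open>3 / 2 * \<delta> - 1 / 2\<close>; the constant part drops out against any
  function with sum zero, in particular against the coordinates of the vertices.\<close>

lemma vertex_pick: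
  fixes f :: "nat \<Rightarrow> complex"
  assumes "i \<in> {1..3}" and f: "(\<Sum>j\<in>{1..3}. f j) = 0"
  shows "2 / 3 * (\<Sum>j\<in>{1..3}. f j * (if j = i then 1 else - (1 / 2))) = f i"
proof -
  have "(\<Sum>j\<in>{1..3}. f j * (if j = i then 1 else - (1 / 2))) =
      (\<Sum>j\<in>{1..3}. (if j = i then 3 / 2 * f j else 0) - 1 / 2 * f j)"
    by (intro sum.cong) auto
  also have "\<dots> = (\<Sum>j\<in>{1..3}. if j = i then 3 / 2 * f j else 0) - 1 / 2 * (\<Sum>j\<in>{1..3}. f j)"
    by (simp only: sum_subtractf sum_distrib_left)
  also have "\<dots> = 3 / 2 * f i" using assms by (simp only: f sum.delta finite_atLeastAtMost if_True mult_zero_right diff_zero)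
  finally have eq: "(\<Sum>j\<in>{1..3}. f j * (if j = i then 1 else - (1 / 2))) = 3 / 2 * f i" .
  show ?thesis unfolding eq by simp
qed

lemma triangle_rep_vertex:
  assumes p: "p permutes {1..3}" and i: "i \<in> {1..3}" and a: "a < 2"
  shows "(\<Sum>b<2. triangle_rep p $$ (a, b) * vertex (p i) b) = vertex i a"
proof -
  have "(\<Sum>b<2. triangle_rep p $$ (a, b) * vertex (p i) b) =
      (\<Sum>b<2. \<Sum>j\<in>{1..3}. 2 / 3 * (vertex j a * (vertex (p j) b * vertex (p i) b)))"
    using a by (intro sum.cong) (auto simp: triangle_rep_entry sum_distrib_left sum_distrib_right mult.assoc)
  also have "\<dots> = 2 / 3 * (\<Sum>j\<in>{1..3}. vertex j a * (\<Sum>b<2. vertex (p j) b * vertex (p i) b))"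
    by (subst sum.swap) (simp add: sum_distrib_left)
  also have "\<dots> = 2 / 3 * (\<Sum>j\<in>{1..3}. vertex j a * (if j = i then 1 else - (1 / 2)))"
    using p i permutes_in_image[OF p] permutes_inj[OF p]
    by (intro arg_cong[where f="\<lambda>z. 2 / 3 * z"] sum.cong refl) (simp add: vertex_gram inj_eq)
  also have "\<dots> = vertex i a" using i vertex_sum by (rule vertex_pick)
  finally show ?thesis .
qed

text \<open>The transposed matrix undoes the permutation, sending the vertex \<open>i\<close> to the vertex \<open>p i\<close>.\<close>

lemma triangle_rep_vertex_left:
  assumes p: "p permutes {1..3}" and i: "i \<in> {1..3}" and b: "b < 2"
  shows "(\<Sum>a<2. vertex i a * triangle_rep p $$ (a, b)) = vertex (p i) b"
proof -
  have "(\<Sum>a<2. vertex i a * triangle_rep p $$ (a, b)) =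
      (\<Sum>a<2. \<Sum>j\<in>{1..3}. 2 / 3 * (vertex (p j) b * (vertex j a * vertex i a)))"
    using b by (intro sum.cong) (auto simp: triangle_rep_entry sum_distrib_left sum_distrib_right ac_simps)
  also have "\<dots> = 2 / 3 * (\<Sum>j\<in>{1..3}. vertex (p j) b * (\<Sum>a<2. vertex j a * vertex i a))"
    by (subst sum.swap) (simp add: sum_distrib_left)
  also have "\<dots> = 2 / 3 * (\<Sum>j\<in>{1..3}. vertex (p j) b * (if j = i then 1 else - (1 / 2)))"
    using i by (intro arg_cong[where f="\<lambda>z. 2 / 3 * z"] sum.cong refl) (simp add: vertex_gram)
  also have "\<dots> = vertex (p i) b"
    using i
  proof (rule vertex_pick)
    show "(\<Sum>j\<in>{1..3}. vertex (p j) b) = 0"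
      using sum.permute[OF p, of "\<lambda>j. vertex j b"] vertex_sum[of b] by (simp add: o_def)
  qed
  finally show ?thesis .
qed

lemma triangle_rep_mult:
  assumes \<sigma>: "\<sigma> permutes {1..3}" and \<tau>: "\<tau> permutes {1..3}"
  shows "triangle_rep \<sigma> * triangle_rep \<tau> = triangle_rep (\<tau> \<circ> \<sigma>)"
proof (rule eq_matI)
  fix a b assume "a < dim_row (triangle_rep (\<tau> \<circ> \<sigma>))" "b < dim_col (triangle_rep (\<tau> \<circ> \<sigma>))"
  then have ab: "a < 2" "b < 2" by (auto simp: triangle_rep_def)
  have "(triangle_rep \<sigma> * triangle_rep \<tau>) $$ (a, b) =
      (\<Sum>c<2. triangle_rep \<sigma> $$ (a, c) * triangle_rep \<tau> $$ (c, b))"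
    using ab triangle_rep_carrier[of \<sigma>] triangle_rep_carrier[of \<tau>]
    by (auto simp: scalar_prod_def atLeast0LessThan intro!: sum.cong)
  also have "\<dots> = (\<Sum>c<2. triangle_rep \<sigma> $$ (a, c) * (2 / 3 * (\<Sum>i\<in>{1..3}. vertex (\<sigma> i) c * vertex (\<tau> (\<sigma> i)) b)))"
    using ab sum.permute[OF \<sigma>, of "\<lambda>i. vertex i _ * vertex (\<tau> i) b"]
    by (intro sum.cong refl) (simp add: triangle_rep_entry o_def)
  also have "\<dots> = (\<Sum>c<2. \<Sum>i\<in>{1..3}. 2 / 3 * (triangle_rep \<sigma> $$ (a, c) * vertex (\<sigma> i) c * vertex (\<tau> (\<sigma> i)) b))"
    by (simp add: sum_distrib_left ac_simps)
  also have "\<dots> = 2 / 3 * (\<Sum>i\<in>{1..3}. (\<Sum>c<2. triangle_rep \<sigma> $$ (a, c) * vertex (\<sigma> i) c) * vertex (\<tau> (\<sigma> i)) b)"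
    by (subst sum.swap) (simp add: sum_distrib_left sum_distrib_right)
  also have "\<dots> = 2 / 3 * (\<Sum>i\<in>{1..3}. vertex i a * vertex (\<tau> (\<sigma> i)) b)"
    using triangle_rep_vertex[OF \<sigma> _ ab(1)] by simp
  also have "\<dots> = triangle_rep (\<tau> \<circ> \<sigma>) $$ (a, b)"
    using ab by (simp add: triangle_rep_entry)
  finally show "(triangle_rep \<sigma> * triangle_rep \<tau>) $$ (a, b) = triangle_rep (\<tau> \<circ> \<sigma>) $$ (a, b)" .
qed (simp_all add: triangle_rep_def)

lemma triangle_rep_unitary:
  assumes p: "p permutes {1..3}"
  shows "mat_adjoint (triangle_rep p) * triangle_rep p = 1\<^sub>m 2"
proof (rule eq_matI)
  let ?R = "triangle_rep p"
  have dims: "dim_row ?R = 2" "dim_col ?R = 2" by (simp_all add: triangle_rep_def)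
  have adj: "dim_row (mat_adjoint ?R) = 2" "dim_col (mat_adjoint ?R) = 2"
    by (simp_all add: mat_adjoint_def mat_of_rows_def dims)
  fix a b assume "a < dim_row (1\<^sub>m 2 :: complex mat)" "b < dim_col (1\<^sub>m 2 :: complex mat)"
  then have ab: "a < 2" "b < 2" by auto
  have real: "cnj (vertex i c) = vertex i c" for i c by (simp add: vertex_def)
  have entry: "mat_adjoint ?R $$ (a, c) = ?R $$ (c, a)" if "c < 2" for c
    using that ab by (simp add: mat_adjoint_def mat_of_rows_def dims conjugate_complex_def triangle_rep_entry real)
  have "(mat_adjoint ?R * ?R) $$ (a, b) = (\<Sum>c<2. ?R $$ (c, a) * ?R $$ (c, b))"
    using ab by (auto simp: scalar_prod_def atLeast0LessThan dims adj entry intro!: sum.cong)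
  also have "\<dots> = (\<Sum>c<2. \<Sum>i\<in>{1..3}. 2 / 3 * (vertex (p i) a * (vertex i c * ?R $$ (c, b))))"
    using ab by (intro sum.cong refl) (simp add: triangle_rep_entry[of _ a] sum_distrib_left sum_distrib_right ac_simps)
  also have "\<dots> = 2 / 3 * (\<Sum>i\<in>{1..3}. vertex (p i) a * (\<Sum>c<2. vertex i c * ?R $$ (c, b)))"
    by (subst sum.swap) (simp add: sum_distrib_left)
  also have "\<dots> = 2 / 3 * (\<Sum>i\<in>{1..3}. vertex (p i) a * vertex (p i) b)"
    using triangle_rep_vertex_left[OF p _ ab(2)] by simp
  also have "\<dots> = 2 / 3 * (\<Sum>i\<in>{1..3}. vertex i a * vertex i b)"
    using sum.permute[OF p, of "\<lambda>i. vertex i a * vertex i b"] by (simp add: o_def)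
  also have "\<dots> = 1\<^sub>m 2 $$ (a, b)" using vertex_frame[OF ab] ab by simp
  finally show "(mat_adjoint ?R * ?R) $$ (a, b) = 1\<^sub>m 2 $$ (a, b)" .
qed (simp_all add: triangle_rep_def mat_adjoint_def mat_of_rows_def)

lemma triangle_rep_unitary_rep: "unitary_rep S3 2 triangle_rep"
  unfolding unitary_rep_def
  using triangle_rep_carrier triangle_rep_mult triangle_rep_unitary
  by (auto simp: hom_def ring_mat_simps carrier_S3 mult_S3)

lemma triangle_rep_faithful:
  assumes p: "p permutes {1..3}" and one: "triangle_rep p = 1\<^sub>m 2"
  shows "p = id"
proof
  fix i
  show "p i = id i"
  proof (cases "i \<in> {1..3}")
    case i: True
    have "vertex (p i) a = vertex i a" if "a < 2" for a
      using triangle_rep_vertex[OF p i that] that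
      by (auto simp: one numeral_2_eq_2 lessThan_Suc less_Suc_eq)
    then have eq: "vertex (p i) 0 = vertex i 0" "vertex (p i) 1 = vertex i 1" by auto
    have "p i \<in> {1..3}" using i permutes_in_image[OF p] by simp
    then have "p i = 1 \<or> p i = 2 \<or> p i = 3" "i = 1 \<or> i = 2 \<or> i = 3" using i by auto
    then show ?thesis using eq by (elim disjE) (auto simp: vertex_def)
  next
    case False
    then show ?thesis using p by (simp add: permutes_not_in)
  qed
qed

lemma triangle_rep_12: "triangle_rep (Transposition.transpose 1 2) = mat 2 2 (\<lambda>(a, b). if a = b then (if a = 0 then 1 else - 1) else 0)"
proof (rule eq_matI)
  fix a b assume "a < dim_row (mat 2 2 (\<lambda>(a, b). if a = b then (if a = 0 then 1 else - 1) else 0 :: complex))"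
    "b < dim_col (mat 2 2 (\<lambda>(a, b). if a = b then (if a = 0 then 1 else - 1) else 0 :: complex))"
  then have ab: "a < 2" "b < 2" by auto
  then show "triangle_rep (Transposition.transpose 1 2) $$ (a, b) =
      mat 2 2 (\<lambda>(a, b). if a = b then (if a = 0 then 1 else - 1) else 0) $$ (a, b)"
    unfolding triangle_rep_entry[OF ab] sum_1_3
    by (auto simp: less_2_cases_iff vertex_def sqrt3_squared)
qed (simp_all add: triangle_rep_def)

abbreviation vertex_vec :: "nat \<Rightarrow> complex vec" where
  "vertex_vec i \<equiv> vec 2 (vertex i)"

lemma triangle_rep_mult_vertex:
  assumes "p permutes {1..3}" "i \<in> {1..3}"
  shows "triangle_rep p *\<^sub>v vertex_vec (p i) = vertex_vec i"
proof (rule eq_vecI)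
  fix a assume "a < dim_vec (vertex_vec i)"
  then have a: "a < 2" by simp
  have "vec_index (triangle_rep p *\<^sub>v vertex_vec (p i)) a = (\<Sum>b<2. triangle_rep p $$ (a, b) * vertex (p i) b)"
    using a triangle_rep_carrier[of p] by (auto simp: scalar_prod_def atLeast0LessThan intro!: sum.cong)
  then show "vec_index (triangle_rep p *\<^sub>v vertex_vec (p i)) a = vec_index (vertex_vec i) a"
    using triangle_rep_vertex[OF assms a] a by simp
qed (simp add: triangle_rep_def)

text \<open>An invariant subspace that contains one vertex contains all three by symmetry, hence two
  independent vectors.  A vector with nonzero first coordinate yields vertex \<open>3\<close> by averaging it with its
  reflection under \<open>(12)\<close>.  A nonzero vector with first coordinate zero is turned by the symmetry \<open>(13)\<close>
  into one whose first coordinate is not zero.\<close>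

lemma triangle_rep_irreducible: "irreducible_rep S3 2 triangle_rep"
  unfolding irreducible_rep_def
proof (intro conjI allI impI)
  fix W
  assume "VectorSpace.subspace class_ring W (module_vec TYPE(complex) 2) \<and>
      (\<forall>g\<in>carrier S3. \<forall>w\<in>W. triangle_rep g *\<^sub>v w \<in> W)"
  then have sub: "LinearCombinations.submodule class_ring W (module_vec TYPE(complex) 2)"
    and inv: "\<And>g w. g permutes {1..3} \<Longrightarrow> w \<in> W \<Longrightarrow> triangle_rep g *\<^sub>v w \<in> W"
    by (auto simp: VectorSpace.subspace_def carrier_S3)
  have W: "W \<subseteq> carrier_vec 2"
    using LinearCombinations.submodule.subset[OF sub] by (simp add: module_vec_simps)
  have zero: "0\<^sub>v 2 \<in> W"
    using LinearCombinations.submodule.zero_closed[OF sub] by (simp add: module_vec_simps)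
  have add: "v + w \<in> W" if "v \<in> W" "w \<in> W" for v w
    using LinearCombinations.submodule.m_closed[OF sub that] by (simp add: module_vec_simps)
  have smult: "c \<cdot>\<^sub>v w \<in> W" if "w \<in> W" for c w
    using LinearCombinations.submodule.smult_closed[OF sub _ that] by (simp add: module_vec_simps)
  have vertices: "vertex_vec i \<in> W \<Longrightarrow> j \<in> {1..3} \<Longrightarrow> i \<in> {1..3} \<Longrightarrow> vertex_vec j \<in> W" for i j
    using inv[of "Transposition.transpose i j" "vertex_vec i"]
      triangle_rep_mult_vertex[of "Transposition.transpose i j" j]
    by (simp add: permutes_swap_id)
  let ?t = "Transposition.transpose 1 (2::nat)"
  have t: "?t permutes {1..3}" by (intro permutes_swap_id) auto
  have full: "W = carrier_vec 2" if "vertex_vec i \<in> W" "i \<in> {1..3}" for i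
  proof
    have v: "vertex_vec 3 \<in> W" "vertex_vec 1 \<in> W" using vertices[OF that(1) _ that(2)] by auto
    show "carrier_vec 2 \<subseteq> W"
    proof
      fix w :: "complex vec" assume w: "w \<in> carrier_vec 2"
      \<comment> \<open>vertex 1 supplies the second coordinate; the multiple of vertex 3 corrects the first\<close>
      let ?d = "vec_index w 1 / of_real (sqrt 3 / 2)"
      have "w = (vec_index w 0 + ?d / 2) \<cdot>\<^sub>v vertex_vec 3 + ?d \<cdot>\<^sub>v vertex_vec 1"
        using w by (intro eq_vecI) (auto simp: less_2_cases_iff vertex_def)
      moreover have "\<dots> \<in> W" using v by (intro add smult)
      ultimately show "w \<in> W" by simp
    qed
  qed (rule W)
  have first: "W = carrier_vec 2" if w: "w \<in> W" "vec_index w 0 \<noteq> 0" for w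
  proof -
    have car: "w \<in> carrier_vec 2" using w W by auto
    have "vertex_vec 3 = (1 / (2 * vec_index w 0)) \<cdot>\<^sub>v (w + triangle_rep ?t *\<^sub>v w)"
      using car w(2) unfolding triangle_rep_12
      by (intro eq_vecI) (auto simp: less_Suc_eq vertex_def scalar_prod_def numeral_2_eq_2)
    moreover have "\<dots> \<in> W" using w(1) t by (intro smult add inv)
    ultimately have "vertex_vec 3 \<in> W" by simp
    then show ?thesis by (rule full) simp
  qed
  show "W = {0\<^sub>v 2} \<or> W = carrier_vec 2"
  proof (cases "\<exists>w\<in>W. vec_index w 0 \<noteq> 0")
    case True
    then show ?thesis using first by blast
  next
    case False
    have "w = 0\<^sub>v 2" if w: "w \<in> W" for w
    proof (rule eq_vecI)
      let ?s = "Transposition.transpose 1 (3::nat)"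
      have car: "w \<in> carrier_vec 2" using w W by auto
      have "?s permutes {1..3}" by (intro permutes_swap_id) auto
      then have "triangle_rep ?s *\<^sub>v w \<in> W" using w by (rule inv)
      then have "vec_index (triangle_rep ?s *\<^sub>v w) 0 = 0" using False by blast
      moreover have "vec_index (triangle_rep ?s *\<^sub>v w) 0 =
          triangle_rep ?s $$ (0, 0) * vec_index w 0 + triangle_rep ?s $$ (0, 1) * vec_index w 1"
        using car triangle_rep_carrier[of ?s] by (simp add: scalar_prod_def numeral_2_eq_2)
      moreover have "triangle_rep ?s $$ (0, 1) = of_real (sqrt 3 / 2)"
        using triangle_rep_entry[of 0 1 ?s] unfolding sum_1_3 by (simp add: vertex_def)
      then have "triangle_rep ?s $$ (0, 1) \<noteq> 0" by (simp only:) simp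
      ultimately have "vec_index w 1 = 0" "vec_index w 0 = 0" using False w by auto
      then show "vec_index w a = vec_index (0\<^sub>v 2) a" if "a < dim_vec (0\<^sub>v 2 :: complex vec)" for a
        using that by (auto simp: less_2_cases_iff)
      show "dim_vec w = dim_vec (0\<^sub>v 2 :: complex vec)" using car by simp
    qed
    then show ?thesis using zero by blast
  qed
qed simp

text \<open>The supremum that defines the operator norm is taken over a set which contains the value \<open>1\<close> at the
  first unit vector and is bounded because dropping a coordinate does not increase the length.\<close>

lemma op_norm_ge_1:
  assumes A: "A = mat 2 2 (\<lambda>(a, b). if a = 0 \<and> b = 0 then 1 else 0)"
  shows "op_norm A \<ge> 1"
proof -
  have Av: "A *\<^sub>v v = vec 2 (\<lambda>a. if a = 0 then vec_index v 0 else 0)" if "v \<in> carrier_vec 2" for v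
    using that by (intro eq_vecI) (auto simp: A scalar_prod_def numeral_2_eq_2 less_Suc_eq)
  have norm: "l2_norm (A *\<^sub>v v) = cmod (vec_index v 0)" if "v \<in> carrier_vec 2" for v
    unfolding Av[OF that] l2_norm_def by (simp add: numeral_2_eq_2 lessThan_Suc)
  have dim: "dim_col A = 2" by (simp add: A)
  let ?S = "{l2_norm (A *\<^sub>v v) | v. v \<in> carrier_vec (dim_col A) \<and> l2_norm v \<le> 1}"
  have "bdd_above ?S"
  proof (rule bdd_aboveI)
    fix x assume "x \<in> ?S"
    then obtain v where v: "v \<in> carrier_vec 2" "l2_norm v \<le> 1" "x = cmod (vec_index v 0)"
      using norm by (auto simp: dim)
    have "cmod (vec_index v 0) = sqrt ((cmod (vec_index v 0))\<^sup>2)" by simp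
    also have "\<dots> \<le> l2_norm v"
      unfolding l2_norm_def using v(1) by (intro real_sqrt_le_mono) (simp add: numeral_2_eq_2 lessThan_Suc)
    finally show "x \<le> 1" using v by simp
  qed
  moreover have "1 \<in> ?S"
  proof -
    have "unit_vec 2 0 \<in> carrier_vec (dim_col A)" by (simp add: dim)
    moreover have "l2_norm (unit_vec 2 0) \<le> 1" by (simp add: l2_norm_def numeral_2_eq_2 lessThan_Suc)
    moreover have "1 = l2_norm (A *\<^sub>v unit_vec 2 0)" by (simp add: norm)
    ultimately show ?thesis by blast
  qed
  ultimately show ?thesis unfolding op_norm_def by (intro cSup_upper)
qed

lemma triangle_rep_in_reps1:
  assumes \<mu>: "\<And>k. k \<le> 0 \<Longrightarrow> \<mu> k = nuo"
  shows "(2, triangle_rep) \<in> reps1 S3 \<mu>"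
proof -
  interpret subgroup_noise S3 Ho \<mu> using \<mu> by (rule subgroup_noise_S3)
  have id: "triangle_rep id = 1\<^sub>m 2"
    using unitary_rep_one[OF triangle_rep_unitary_rep] by (simp add: one_S3)
  have "rep_mean \<mu> 2 triangle_rep 0 = mat 2 2 (\<lambda>(a, b). if a = 0 \<and> b = 0 then 1 else 0)"
  proof -
    have "(\<Sum>h\<in>Ho. f h) = f id + f (Transposition.transpose 1 2)" for f :: "_ \<Rightarrow> complex"
      unfolding Ho_eq using transpose_12_neq_id by (subst sum.insert) auto
    then show ?thesis
      by (intro eq_matI)
        (auto simp: rep_mean_eq card_Ho id triangle_rep_12[unfolded One_nat_def] less_2_cases_iff)
  qed
  then have "r1 \<mu> 2 triangle_rep 0 > 0"
    using op_norm_ge_1 r1_eq[OF triangle_rep_unitary_rep, of 0] by force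
  then show ?thesis
    using triangle_rep_unitary_rep triangle_rep_irreducible
    by (auto simp: reps1_def unitary_irreps_def intro!: exI[of _ 0])
qed

section \<open>Extremal solutions and kernels for the symmetric group\<close>

theorem proposition6p4:
  fixes \<mu> :: "int \<Rightarrow> (nat \<Rightarrow> nat) measure"
  assumes "\<And>k. k \<le> 0 \<Longrightarrow> \<mu> k = nuo"
  shows "\<exists>Po \<in> solutions S3 \<mu>.
    (\<forall>k\<le>0. distr Po (count_space (carrier S3)) (\<lambda>\<eta>. \<eta> k)
             = uniform_measure (count_space (carrier S3)) Ho) \<and>
    extremal_solutions S3 \<mu> =
      {Po, translate S3 (cycle_of_list [1, 3]) Po, translate S3 (cycle_of_list [1, 2, 3]) Po} \<and>
    isotropy S3 Po = Ho \<and>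
    {\<one>\<^bsub>S3\<^esub>} = H1 S3 \<mu> \<and> H1 S3 \<mu> \<subset> isotropy S3 Po \<and>
    (\<forall>P \<in> extremal_solutions S3 \<mu>. Ho \<subset> Hs S3 P \<and> Hs S3 P = H2 S3 \<mu>) \<and>
    H2 S3 \<mu> = carrier S3"
proof -
  interpret subgroup_noise S3 Ho \<mu> using assms by (rule subgroup_noise_S3)
  let ?C = "{id, cycle_of_list [1, 3], cycle_of_list [1, 2, 3]} :: (nat \<Rightarrow> nat) set"
  have C: "?C \<subseteq> carrier S3"
    using transposition_in_S3 by (auto simp: carrier_S3 intro!: permutes_compose permutes_swap_id permutes_id)
  have "translate S3 id iid = iid"
    using translate_iid_eq_iff[of id] one_in_H one_closed by (simp add: one_S3)
  moreover have "(\<lambda>g. translate S3 g iid) ` carrier S3 = (\<lambda>c. translate S3 c iid) ` ?C"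
  proof (rule subset_antisym[OF _ image_mono[OF C]], rule image_subsetI)
    fix g assume "g \<in> carrier S3"
    from left_cosets_of_Ho[OF this] obtain c h where ch: "c \<in> ?C" "h \<in> Ho" "g = c \<otimes>\<^bsub>S3\<^esub> h" .
    have "translate S3 g iid = translate S3 c (translate S3 h iid)"
      unfolding ch(3) using C ch(1) by (intro translate_translate[symmetric] iid_solution in_carrier[OF ch(2)]) auto
    also have "translate S3 h iid = iid"
      using translate_iid_eq_iff[OF in_carrier[OF ch(2)]] ch(2) by simp
    finally show "translate S3 g iid \<in> (\<lambda>c. translate S3 c iid) ` ?C" using ch(1) by (rule image_eqI)
  qed
  ultimately have ext: "extremal_solutions S3 \<mu> =
      {iid, translate S3 (cycle_of_list [1, 3]) iid, translate S3 (cycle_of_list [1, 2, 3]) iid}"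
    unfolding extremal_solutions_eq by (simp del: cycle_of_list.simps)
  have H1: "H1 S3 \<mu> = {\<one>\<^bsub>S3\<^esub>}"
  proof (intro subset_antisym subsetI)
    fix g assume "g \<in> H1 S3 \<mu>"
    then have "g permutes {1..3}" "\<forall>(n, \<rho>)\<in>reps1 S3 \<mu>. \<rho> g = 1\<^sub>m n"
      by (simp_all add: H1_def common_kernel_def carrier_S3)
    moreover have "(2, triangle_rep) \<in> reps1 S3 \<mu>" using assms by (rule triangle_rep_in_reps1)
    ultimately have "g permutes {1..3}" "triangle_rep g = 1\<^sub>m 2" by auto
    then show "g \<in> {\<one>\<^bsub>S3\<^esub>}" using triangle_rep_faithful by (simp add: one_S3)
  next
    fix g assume "g \<in> {\<one>\<^bsub>S3\<^esub>}"
    then show "g \<in> H1 S3 \<mu>"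
      using unitary_rep_one one_closed by (auto simp: H1_def common_kernel_def reps1_def unitary_irreps_def)
  qed
  have H2: "H2 S3 \<mu> = carrier S3"
    unfolding H2_def common_kernel_def
    using reps2_trivial_on_H unitary_rep_S3_trivial
    by (fastforce simp: reps2_def unitary_irreps_def)
  have Hs: "Hs S3 P = carrier S3" if "P \<in> extremal_solutions S3 \<mu>" for P
  proof -
    from that obtain g where g: "g \<in> carrier S3" "P = translate S3 g iid"
      unfolding extremal_solutions_eq by blast
    have "\<rho> x = 1\<^sub>m n" if reps: "(n, \<rho>) \<in> reps_s S3 P" and x: "x \<in> carrier S3" for n \<rho> x
    proof -
      have \<rho>: "unitary_rep S3 n \<rho>" using reps by (simp add: reps_s_def unitary_irreps_def)
      have "\<rho> h = 1\<^sub>m n" if "h \<in> Ho" for h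
        using reps_s_trivial_on_H[OF reps[unfolded g(2)] g(1) that] .
      from unitary_rep_S3_trivial[OF \<rho> this x] show ?thesis .
    qed
    then show ?thesis unfolding Hs_def common_kernel_def by auto
  qed
  have strict: "{\<one>\<^bsub>S3\<^esub>} \<subset> Ho"
    using transpose_12_neq_id by (auto simp: one_S3 Ho_eq)
  have "Ho \<subset> carrier S3"
  proof
    show "Ho \<subseteq> carrier S3" by (rule H_subset)
    have "Transposition.transpose 1 3 \<in> carrier S3" by (intro transposition_in_S3) auto
    moreover have "h 3 = 3" if "h \<in> Ho" for h using that by (auto simp: Ho_eq)
    then have "Transposition.transpose 1 3 \<notin> Ho" by force
    ultimately show "Ho \<noteq> carrier S3" by blast
  qed
  then show ?thesis
    using iid_solution coordinate_law_iid ext isotropy_iid H1 H2 Hs strict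
    by (intro bexI[of _ iid]) (auto simp del: cycle_of_list.simps)
qed

end
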